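(* There exists a universal constant $C>1$ such that for every $N\ge1$ and every non-zero linear map $T:M(N)\to M(N)$ there exist non-zero orthogonal projections $P,Q\in M(N)$ with $$\frac{\|T\|_{2\to2}}{C\log(h(T)+1)}<\frac{|\langle T(P),Q\rangle_{\mathrm{HS}}|}{\sqrt{\operatorname{tr}(P)\operatorname{tr}(Q)}}\le\|T\|_{2\to2}.$$
   Context: $M(N)$ is the space of $N\times N$ complex matrices with Hilbert–Schmidt inner product $\langle A,B\rangle_{\mathrm{HS}}=\operatorname{tr}(A^*B)$. $\|A\|_p$ is the Schatten-$p$ norm for $1\le p<\infty$ and $\|A\|_\infty$ the operator norm; $\|T\|_{p\to p}=\sup_{X\ne0}\|T(X)\|_p/\|X\|_p$. The height of a non-zero linear map is $h(T)=\sqrt{\|T\|_{1\to1}\|T\|_{\infty\to\infty}}/\|T\|_{2\to2}$. *)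

theory Defs
  imports Complex_Main "Jordan_Normal_Form.Matrix"
begin

text \<open>Matrices in M(N) are represented as elements of carrier_mat N N of type complex mat.\<close>

definition mtrace :: "complex mat \<Rightarrow> complex" where
  "mtrace A = (\<Sum>i<dim_row A. A $$ (i, i))"

definition adj :: "complex mat \<Rightarrow> complex mat" where
  "adj A = mat (dim_col A) (dim_row A) (\<lambda>(i, j). cnj (A $$ (j, i)))"

definition hs_inner :: "complex mat \<Rightarrow> complex mat \<Rightarrow> complex" where
  "hs_inner A B = mtrace (adj A * B)"

definition vinner :: "complex vec \<Rightarrow> complex vec \<Rightarrow> complex" where
  "vinner v w = (\<Sum>i<dim_vec v. cnj (v $ i) * w $ i)"

definition vnorm :: "complex vec \<Rightarrow> real" where
  "vnorm v = sqrt (\<Sum>i<dim_vec v. (cmod (v $ i))\<^sup>2)"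

definition psd :: "complex mat \<Rightarrow> bool" where
  "psd B \<longleftrightarrow> dim_row B = dim_col B \<and> adj B = B \<and>
     (\<forall>v \<in> carrier_vec (dim_col B). 0 \<le> Re (vinner v (B *\<^sub>v v)))"

text \<open>Absolute value |A| = (A^* A)^(1/2), the unique PSD square root.\<close>
definition mat_abs :: "complex mat \<Rightarrow> complex mat" where
  "mat_abs A = (THE B. B \<in> carrier_mat (dim_col A) (dim_col A) \<and> psd B \<and> B * B = adj A * A)"

definition schatten :: "nat \<Rightarrow> complex mat \<Rightarrow> real" where
  "schatten p A = Re (mtrace (mat_abs A ^\<^sub>m p)) powr (1 / real p)"

definition op_norm :: "complex mat \<Rightarrow> real" where
  "op_norm A = Sup {vnorm (A *\<^sub>v v) / vnorm v | v. v \<in> carrier_vec (dim_col A) \<and> v \<noteq> 0\<^sub>v (dim_col A)}"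

definition map_norm :: "(complex mat \<Rightarrow> real) \<Rightarrow> nat \<Rightarrow> (complex mat \<Rightarrow> complex mat) \<Rightarrow> real" where
  "map_norm nrm N T = Sup {nrm (T X) / nrm X | X. X \<in> carrier_mat N N \<and> X \<noteq> 0\<^sub>m N N}"

definition height :: "nat \<Rightarrow> (complex mat \<Rightarrow> complex mat) \<Rightarrow> real" where
  "height N T = sqrt (map_norm (schatten 1) N T * map_norm op_norm N T) / map_norm (schatten 2) N T"

text \<open>Linear maps M(N) \<rightarrow> M(N) (only their behaviour on carrier_mat N N matters).\<close>
definition lin_map :: "nat \<Rightarrow> (complex mat \<Rightarrow> complex mat) \<Rightarrow> bool" where
  "lin_map N T \<longleftrightarrow>
     (\<forall>X \<in> carrier_mat N N. T X \<in> carrier_mat N N) \<and>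
     (\<forall>X \<in> carrier_mat N N. \<forall>Y \<in> carrier_mat N N. T (X + Y) = T X + T Y) \<and>
     (\<forall>c. \<forall>X \<in> carrier_mat N N. T (c \<cdot>\<^sub>m X) = c \<cdot>\<^sub>m T X)"

definition orth_proj :: "nat \<Rightarrow> complex mat \<Rightarrow> bool" where
  "orth_proj N P \<longleftrightarrow> P \<in> carrier_mat N N \<and> adj P = P \<and> P * P = P"

end

theory Submission
  imports Defs "Jordan_Normal_Form.Spectral_Radius" "HOL-Analysis.L2_Norm"
begin

text \<open>
  Let \<open>X\<close> nearly attain \<open>\<parallel>T\<parallel>\<close> on Hilbert--Schmidt space and let \<open>Y\<close> be the normalised image
  of \<open>X\<close>. Passing to Hermitian parts loses a factor 4, so \<open>X = \<Sum> x\<^sub>i p\<^sub>i\<close> and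
  \<open>Y = \<Sum> y\<^sub>j q\<^sub>j\<close> with rank-one spectral projections, and with \<open>b\<^sub>i\<^sub>j = \<langle>q\<^sub>j, T p\<^sub>i\<rangle>\<close> the sum
  \<open>\<Sum> x\<^sub>i y\<^sub>j b\<^sub>i\<^sub>j\<close> is comparable to \<open>\<parallel>T\<parallel>\<close>. Group the \<open>x\<^sub>i\<close> and the \<open>y\<^sub>j\<close> into dyadic
  levels. By Hoelder's inequality the rows of \<open>b\<close> are bounded through the \<open>1\<rightarrow>1\<close> norm of \<open>T\<close>
  and its columns through the \<open>\<infinity>\<rightarrow>\<infinity>\<close> norm, so pairs of levels that are far apart contribute
  little. Only \<open>O(log (h + 1))\<close> differences of levels remain. For each of them, convexity
  replaces the coefficients within a level by indicators of subsets, that is, by spectral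
  projections, and Cauchy--Schwarz bounds the contribution by the largest normalised pairing
  \<open>M\<close> of such projections. Hence \<open>\<parallel>T\<parallel> \<le> C M log (h + 1)\<close>; a Schur test gives the lower bound on
  \<open>h\<close> that lets \<open>log (h + 1)\<close> absorb additive constants.
\<close>

section \<open>Bilinear sums over finite index sets\<close>

text \<open>The modulus of an affine function is convex, so over the box \<open>[0, c]^A\<close> it
  is largest at a vertex, and the vertices are \<open>c\<close> times the indicators of subsets. The
  offset \<open>w\<close> carries the coordinates that have already been moved to an end point,
  which is what the induction needs.\<close>

lemma cmod_box_sum_le:
  fixes z :: "'a \<Rightarrow> complex" and x :: "'a \<Rightarrow> real"
  assumes "finite A" "\<And>i. i \<in> A \<Longrightarrow> 0 \<le> x i \<and> x i \<le> c" "0 < c"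
    and "\<And>S. S \<subseteq> A \<Longrightarrow> cmod (w + of_real c * (\<Sum>i\<in>S. z i)) \<le> D"
  shows "cmod (w + (\<Sum>i\<in>A. of_real (x i) * z i)) \<le> D"
  using assms(1,2,4)
proof (induction A arbitrary: w rule: finite_induct)
  case empty
  then show ?case using empty(2)[of "{}"] by simp
next
  case (insert a A)
  define r where "r = (\<Sum>i\<in>A. of_real (x i) * z i)"
  define t where "t = x a / c"
  have t: "0 \<le> t" "t \<le> 1" using insert.prems(1)[of a] assms(3) by (auto simp: t_def field_simps)
  have xa: "x a = t * c" using assms(3) by (simp add: t_def)
  have 1: "cmod (w + r) \<le> D" unfolding r_def
    by (rule insert.IH) (use insert.prems in auto)
  have 2: "cmod (w + of_real c * z a + r) \<le> D" unfolding r_def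
  proof (rule insert.IH)
    fix S assume S: "S \<subseteq> A"
    then have "finite S" "a \<notin> S" using insert.hyps finite_subset by auto
    then have "(\<Sum>i\<in>insert a S. z i) = z a + (\<Sum>i\<in>S. z i)" by simp
    moreover have "insert a S \<subseteq> insert a A" using S by auto
    ultimately show "cmod (w + of_real c * z a + of_real c * (\<Sum>i\<in>S. z i)) \<le> D"
      using insert.prems(2)[of "insert a S"] by (simp add: algebra_simps)
  qed (use insert.prems in auto)
  \<comment> \<open>The expression is affine in the coordinate \<open>x a = t * c\<close>, hence a
    convex combination of its values at \<open>x a = 0\<close> and \<open>x a = c\<close>.\<close>
  have "w + (\<Sum>i\<in>insert a A. of_real (x i) * z i)
      = of_real (1 - t) * (w + r) + of_real t * (w + of_real c * z a + r)"
    using insert.hyps by (simp add: r_def xa algebra_simps)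
  also have "cmod \<dots> \<le> (1 - t) * cmod (w + r) + t * cmod (w + of_real c * z a + r)"
    by (rule order.trans[OF norm_triangle_ineq]) (use t in \<open>simp add: norm_mult del: of_real_diff\<close>)
  also have "\<dots> \<le> (1 - t) * D + t * D"
    using 1 2 t by (intro add_mono mult_left_mono) auto
  finally show ?case by (simp add: algebra_simps)
qed

text \<open>Splitting by the sign of \<open>x\<close> leaves two box sums, each of modulus at most
  \<open>c * D\<close>.\<close>

lemma cmod_signed_sum_le:
  fixes z :: "'a \<Rightarrow> complex" and x :: "'a \<Rightarrow> real"
  assumes A: "finite A" and x: "\<And>i. i \<in> A \<Longrightarrow> \<bar>x i\<bar> \<le> c" and c: "0 < c"
    and D: "\<And>S. S \<subseteq> A \<Longrightarrow> cmod (\<Sum>i\<in>S. z i) \<le> D"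
  shows "cmod (\<Sum>i\<in>A. of_real (x i) * z i) \<le> 2 * c * D"
proof -
  define P where "P = {i\<in>A. 0 \<le> x i}"
  define Q where "Q = {i\<in>A. x i < 0}"
  have *: "cmod (of_real c * (\<Sum>i\<in>S. z i)) \<le> c * D" if "S \<subseteq> A" for S
    using D[OF that] c by (simp add: norm_mult)
  have "cmod (0 + (\<Sum>i\<in>P. of_real (x i) * z i)) \<le> c * D"
    by (rule cmod_box_sum_le[OF _ _ c])
       (use A * x in \<open>auto simp: P_def subset_iff abs_le_iff\<close>)
  moreover have "cmod (0 + (\<Sum>i\<in>Q. of_real (- x i) * z i)) \<le> c * D"
    by (rule cmod_box_sum_le[OF _ _ c])
       (use A * x in \<open>auto simp: Q_def subset_iff abs_le_iff\<close>)
  moreover have "(\<Sum>i\<in>A. of_real (x i) * z i)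
      = (\<Sum>i\<in>P. of_real (x i) * z i) + (\<Sum>i\<in>Q. of_real (x i) * z i)"
    by (subst sum.union_disjoint[symmetric]) (use A in \<open>auto simp: P_def Q_def intro!: sum.cong\<close>)
  moreover have "(\<Sum>i\<in>Q. of_real (- x i) * z i) = - (\<Sum>i\<in>Q. of_real (x i) * z i)"
    by (simp add: sum_negf)
  ultimately show ?thesis
    using norm_triangle_ineq[of "\<Sum>i\<in>P. of_real (x i) * z i" "\<Sum>i\<in>Q. of_real (x i) * z i"]
    by simp
qed

text \<open>Real and imaginary parts, each split by sign, produce four subset sums without
  cancellation, whence the factor 4.\<close>

lemma sum_cmod_le_subset_sums:
  fixes z :: "'a \<Rightarrow> complex"
  assumes A: "finite A" and D: "\<And>S. S \<subseteq> A \<Longrightarrow> cmod (\<Sum>i\<in>S. z i) \<le> D"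
  shows "(\<Sum>i\<in>A. cmod (z i)) \<le> 4 * D"
proof -
  have *: "(\<Sum>i\<in>A. \<bar>f (z i)\<bar>) \<le> 2 * D"
    if f: "\<And>S. f (\<Sum>i\<in>S. z i) = (\<Sum>i\<in>S. f (z i))" "\<And>w. \<bar>f w\<bar> \<le> cmod w"
    for f :: "complex \<Rightarrow> real"
  proof -
    define P where "P = {i\<in>A. 0 \<le> f (z i)}"
    define Q where "Q = {i\<in>A. f (z i) < 0}"
    have "(\<Sum>i\<in>A. \<bar>f (z i)\<bar>) = (\<Sum>i\<in>P. \<bar>f (z i)\<bar>) + (\<Sum>i\<in>Q. \<bar>f (z i)\<bar>)"
      by (subst sum.union_disjoint[symmetric]) (use A in \<open>auto simp: P_def Q_def intro!: sum.cong\<close>)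
    also have "\<dots> = f (\<Sum>i\<in>P. z i) - f (\<Sum>i\<in>Q. z i)"
      by (simp add: f(1) P_def Q_def sum_negf)
    also have "\<dots> \<le> D + D"
      using f(2)[of "\<Sum>i\<in>P. z i"] f(2)[of "\<Sum>i\<in>Q. z i"] D[of P] D[of Q]
      by (auto simp: P_def Q_def)
    finally show ?thesis by simp
  qed
  have "(\<Sum>i\<in>A. cmod (z i)) \<le> (\<Sum>i\<in>A. \<bar>Re (z i)\<bar> + \<bar>Im (z i)\<bar>)"
    by (intro sum_mono cmod_le)
  also have "\<dots> \<le> 2 * D + 2 * D"
    unfolding sum.distrib by (intro add_mono *) (auto simp: abs_Re_le_cmod abs_Im_le_cmod)
  finally show ?thesis by simp
qed

text \<open>The signed bound is used once per variable, first in \<open>i\<close> and then in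
  \<open>j\<close> over a fixed subset \<open>S\<close>. Each use costs a factor 2.\<close>

lemma cmod_bilinear_sum_le:
  fixes b :: "'a \<Rightarrow> 'b \<Rightarrow> complex" and x :: "'a \<Rightarrow> real" and y :: "'b \<Rightarrow> real"
  assumes A: "finite A" "finite B"
    and x: "\<And>i. i \<in> A \<Longrightarrow> \<bar>x i\<bar> \<le> c" "0 < c" and y: "\<And>j. j \<in> B \<Longrightarrow> \<bar>y j\<bar> \<le> d" "0 < d"
    and D: "\<And>S R. S \<subseteq> A \<Longrightarrow> R \<subseteq> B \<Longrightarrow> cmod (\<Sum>i\<in>S. \<Sum>j\<in>R. b i j) \<le> D"
  shows "cmod (\<Sum>i\<in>A. \<Sum>j\<in>B. of_real (x i * y j) * b i j) \<le> 4 * c * d * D"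
proof -
  have "cmod (\<Sum>i\<in>A. of_real (x i) * (\<Sum>j\<in>B. of_real (y j) * b i j)) \<le> 2 * c * (2 * d * D)"
  proof (rule cmod_signed_sum_le[OF A(1) x])
    fix S assume S: "S \<subseteq> A"
    have "cmod (\<Sum>j\<in>B. of_real (y j) * (\<Sum>i\<in>S. b i j)) \<le> 2 * d * D"
      by (rule cmod_signed_sum_le[OF A(2) y], assumption, subst sum.swap, rule D[OF S])
    also have "(\<Sum>j\<in>B. of_real (y j) * (\<Sum>i\<in>S. b i j)) = (\<Sum>i\<in>S. \<Sum>j\<in>B. of_real (y j) * b i j)"
      by (simp add: sum_distrib_left sum.swap[of _ S B])
    finally show "cmod (\<Sum>i\<in>S. \<Sum>j\<in>B. of_real (y j) * b i j) \<le> 2 * d * D" .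
  qed
  then show ?thesis by (simp add: sum_distrib_left mult.assoc)
qed

section \<open>Dyadic decomposition of a bilinear sum\<close>

definition dyadic_level :: "real \<Rightarrow> int" where
  "dyadic_level x = \<lfloor>log 2 \<bar>x\<bar>\<rfloor>"

lemma dyadic_level_bounds:
  assumes "x \<noteq> 0"
  shows "2 powr (dyadic_level x) \<le> \<bar>x\<bar>" "\<bar>x\<bar> \<le> 2 powr (dyadic_level x + 1)"
proof -
  have "2 powr (dyadic_level x) \<le> 2 powr (log 2 \<bar>x\<bar>)"
    unfolding dyadic_level_def by (rule powr_mono) auto
  then show "2 powr (dyadic_level x) \<le> \<bar>x\<bar>" using assms by simp
  have "2 powr (log 2 \<bar>x\<bar>) \<le> 2 powr (dyadic_level x + 1)"
    unfolding dyadic_level_def by (rule powr_mono) linarith+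
  then show "\<bar>x\<bar> \<le> 2 powr (dyadic_level x + 1)" using assms by simp
qed

text \<open>The level difference \<open>d\<close> is fixed. Between the levels \<open>k\<close> and
  \<open>k + d\<close> the coefficients are bounded by powers of 2 that are sharp up to a factor 2,
  so the pairing bound \<open>M\<close> for indicators controls the block by the geometric mean of
  the two level masses. These masses sum to at most 1 in \<open>x\<close> and in \<open>y\<close>,
  so the bound does not depend on the number of levels.\<close>

lemma dyadic_diagonal_le:
  fixes x y :: "nat \<Rightarrow> real" and b :: "nat \<Rightarrow> nat \<Rightarrow> complex"
  assumes I: "finite I" "\<And>i. i \<in> I \<Longrightarrow> x i \<noteq> 0" and J: "finite J" "\<And>j. j \<in> J \<Longrightarrow> y j \<noteq> 0"
    and x: "(\<Sum>i\<in>I. (x i)\<^sup>2) \<le> 1" and y: "(\<Sum>j\<in>J. (y j)\<^sup>2) \<le> 1" and M: "0 \<le> M"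
    and bM: "\<And>S R. S \<subseteq> I \<Longrightarrow> R \<subseteq> J \<Longrightarrow>
      cmod (\<Sum>i\<in>S. \<Sum>j\<in>R. b i j) \<le> M * sqrt (real (card S) * real (card R))"
  shows "(\<Sum>k\<in>(\<lambda>i. dyadic_level (x i)) ` I.
      cmod (\<Sum>i | i \<in> I \<and> dyadic_level (x i) = k. \<Sum>j | j \<in> J \<and> dyadic_level (y j) = k + d.
        of_real (x i * y j) * b i j)) \<le> 16 * M"
proof -
  define A where "A k = {i \<in> I. dyadic_level (x i) = k}" for k
  define B where "B k = {j \<in> J. dyadic_level (y j) = k}" for k
  define K where "K = (\<lambda>i. dyadic_level (x i)) ` I"
  have fin: "finite (A k)" "finite (B k)" "finite K" for k using I J by (auto simp: A_def B_def K_def)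
  have one: "cmod (\<Sum>i\<in>A k. \<Sum>j\<in>B (k + d). of_real (x i * y j) * b i j)
      \<le> 8 * M * ((\<Sum>i\<in>A k. (x i)\<^sup>2) + (\<Sum>j\<in>B (k + d). (y j)\<^sup>2))" for k
  proof -
    \<comment> \<open>\<open>p\<close> and \<open>q\<close> are lower bounds for the
      \<open>l^2\<close> norms of the coefficients on the two level sets. The inequality
      \<open>2 * p * q \<le> p\<^sup>2 + q\<^sup>2\<close> decouples them, so that the sum over
      \<open>k\<close> sees only total masses.\<close>
    define p where "p = 2 powr (of_int k :: real) * sqrt (real (card (A k)))"
    define q where "q = 2 powr (of_int (k + d) :: real) * sqrt (real (card (B (k + d))))"
    have "cmod (\<Sum>i\<in>A k. \<Sum>j\<in>B (k + d). of_real (x i * y j) * b i j)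
        \<le> 4 * 2 powr (of_int k + 1) * 2 powr (of_int (k + d) + 1)
            * (M * sqrt (real (card (A k)) * real (card (B (k + d)))))"
    proof (rule cmod_bilinear_sum_le[OF fin(1,2)])
      show "\<bar>x i\<bar> \<le> 2 powr (of_int k + 1)" if "i \<in> A k" for i
        using dyadic_level_bounds(2)[of "x i"] I(2)[of i] that by (auto simp: A_def)
      show "\<bar>y j\<bar> \<le> 2 powr (of_int (k + d) + 1)" if "j \<in> B (k + d)" for j
        using dyadic_level_bounds(2)[of "y j"] J(2)[of j] that by (auto simp: B_def)
      fix S R assume SR: "S \<subseteq> A k" "R \<subseteq> B (k + d)"
      have "cmod (\<Sum>i\<in>S. \<Sum>j\<in>R. b i j) \<le> M * sqrt (real (card S) * real (card R))"
        by (rule bM) (use SR in \<open>auto simp: A_def B_def\<close>)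
      also have "\<dots> \<le> M * sqrt (real (card (A k)) * real (card (B (k + d))))"
        by (intro mult_left_mono real_sqrt_le_mono mult_mono) (use M SR fin in \<open>auto intro: card_mono\<close>)
      finally show "cmod (\<Sum>i\<in>S. \<Sum>j\<in>R. b i j) \<le> \<dots>" .
    qed auto
    also have "\<dots> = 8 * M * (2 * p * q)"
      by (simp add: p_def q_def powr_add real_sqrt_mult)
    also have "\<dots> \<le> 8 * M * (p\<^sup>2 + q\<^sup>2)"
      using M sum_squares_bound[of p q] by (intro mult_left_mono) auto
    also have "p\<^sup>2 = (\<Sum>i\<in>A k. (2 powr (of_int k :: real))\<^sup>2)"
      by (simp add: p_def power_mult_distrib)
    also have "\<dots> \<le> (\<Sum>i\<in>A k. (x i)\<^sup>2)"
      using dyadic_level_bounds(1) I(2)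
      by (intro sum_mono) (auto simp: A_def abs_le_square_iff[symmetric])
    also have "q\<^sup>2 = (\<Sum>j\<in>B (k + d). (2 powr (of_int (k + d) :: real))\<^sup>2)"
      by (simp add: q_def power_mult_distrib)
    also have "\<dots> \<le> (\<Sum>j\<in>B (k + d). (y j)\<^sup>2)"
      using dyadic_level_bounds(1) J(2)
      by (intro sum_mono) (force simp: B_def abs_le_square_iff[symmetric])
    finally show ?thesis using M by (simp add: mult_left_mono)
  qed
  have sx: "(\<Sum>k\<in>K. \<Sum>i\<in>A k. (x i)\<^sup>2) \<le> 1"
    using sum.group[OF I(1) fin(3), of "\<lambda>i. dyadic_level (x i)" "\<lambda>i. (x i)\<^sup>2"] x
    by (simp add: K_def A_def)
  \<comment> \<open>For fixed \<open>d\<close> each \<open>j\<close> lies in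
    \<open>B (k + d)\<close> for only one \<open>k\<close>, so the shifted classes are disjoint.
    Indices whose shifted level is outside \<open>K\<close> are dropped.\<close>
  have "(\<Sum>k\<in>K. \<Sum>j\<in>B (k + d). (y j)\<^sup>2) = (\<Sum>j | j \<in> J \<and> dyadic_level (y j) - d \<in> K. (y j)\<^sup>2)"
    using sum.group[of "{j\<in>J. dyadic_level (y j) - d \<in> K}" K "\<lambda>j. dyadic_level (y j) - d" "\<lambda>j. (y j)\<^sup>2"] fin(3) J(1)
    by (auto simp: B_def image_subset_iff intro!: sum.cong elim!: trans[rotated])
  also have "\<dots> \<le> (\<Sum>j\<in>J. (y j)\<^sup>2)" by (rule sum_mono2) (use J in auto)
  finally have sy: "(\<Sum>k\<in>K. \<Sum>j\<in>B (k + d). (y j)\<^sup>2) \<le> 1" using y by simp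
  have "(\<Sum>k\<in>K. cmod (\<Sum>i\<in>A k. \<Sum>j\<in>B (k + d). of_real (x i * y j) * b i j))
      \<le> (\<Sum>k\<in>K. 8 * M * ((\<Sum>i\<in>A k. (x i)\<^sup>2) + (\<Sum>j\<in>B (k + d). (y j)\<^sup>2)))"
    by (intro sum_mono one)
  also have "\<dots> = 8 * M * ((\<Sum>k\<in>K. \<Sum>i\<in>A k. (x i)\<^sup>2) + (\<Sum>k\<in>K. \<Sum>j\<in>B (k + d). (y j)\<^sup>2))"
    by (simp only: sum_distrib_left[symmetric] sum.distrib)
  also have "\<dots> \<le> 8 * M * (1 + 1)"
    using M sx sy by (intro mult_left_mono add_mono) auto
  finally show ?thesis by (simp add: A_def B_def K_def)
qed

text \<open>Bounded subset sums of a row bound its absolute sum by \<open>4 * a\<close>, and the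
  weights \<open>(x i)\<^sup>2\<close> have total at most 1. With the indices exchanged the same
  statement serves for columns.\<close>

lemma row_col_weighted_sum_le:
  fixes x :: "'a \<Rightarrow> real" and b :: "'a \<Rightarrow> 'b \<Rightarrow> complex"
  assumes "finite I" "finite J" "(\<Sum>i\<in>I. (x i)\<^sup>2) \<le> 1" "0 \<le> a"
    and "\<And>i R. i \<in> I \<Longrightarrow> R \<subseteq> J \<Longrightarrow> cmod (\<Sum>j\<in>R. b i j) \<le> a"
  shows "(\<Sum>i\<in>I. \<Sum>j\<in>J. (x i)\<^sup>2 * cmod (b i j)) \<le> 4 * a"
proof -
  have "(\<Sum>i\<in>I. \<Sum>j\<in>J. (x i)\<^sup>2 * cmod (b i j)) \<le> (\<Sum>i\<in>I. (x i)\<^sup>2 * (4 * a))"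
    unfolding sum_distrib_left[symmetric]
    by (intro sum_mono mult_left_mono sum_cmod_le_subset_sums) (use assms in auto)
  also have "\<dots> = (\<Sum>i\<in>I. (x i)\<^sup>2) * (4 * a)" by (simp add: sum_distrib_right)
  also have "\<dots> \<le> 1 * (4 * a)" using assms by (intro mult_right_mono) auto
  finally show ?thesis by simp
qed

text \<open>A weighted inequality between means charges the squares of \<open>x\<close> to the rows
  and those of \<open>y\<close> to the columns. The weight \<open>t\<close> stays free; balancing
  the two terms later gives the a priori lower bound on the height.\<close>

lemma schur_test:
  fixes x y :: "'a \<Rightarrow> real" and b :: "'a \<Rightarrow> 'a \<Rightarrow> complex"
  assumes fin: "finite I" "finite J" and x: "(\<Sum>i\<in>I. (x i)\<^sup>2) \<le> 1" and y: "(\<Sum>j\<in>J. (y j)\<^sup>2) \<le> 1"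
    and pos: "0 \<le> \<alpha>" "0 \<le> \<beta>" "0 < t"
    and row: "\<And>i R. i \<in> I \<Longrightarrow> R \<subseteq> J \<Longrightarrow> cmod (\<Sum>j\<in>R. b i j) \<le> \<alpha>"
    and col: "\<And>j S. j \<in> J \<Longrightarrow> S \<subseteq> I \<Longrightarrow> cmod (\<Sum>i\<in>S. b i j) \<le> \<beta>"
  shows "cmod (\<Sum>i\<in>I. \<Sum>j\<in>J. of_real (x i * y j) * b i j) \<le> 2 * (t * \<alpha> + \<beta> / t)"
proof -
  have *: "\<bar>p * q\<bar> \<le> (t / 2) * p\<^sup>2 + (1 / (2 * t)) * q\<^sup>2" for p q :: real
  proof -
    have "0 \<le> (t * \<bar>p\<bar> - \<bar>q\<bar>)\<^sup>2" by simp
    also have "\<dots> = t\<^sup>2 * p\<^sup>2 - 2 * t * \<bar>p * q\<bar> + q\<^sup>2"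
      by (simp add: power2_eq_square algebra_simps abs_mult)
    finally have "2 * t * \<bar>p * q\<bar> \<le> t\<^sup>2 * p\<^sup>2 + q\<^sup>2" by simp
    then have "\<bar>p * q\<bar> \<le> (t\<^sup>2 * p\<^sup>2 + q\<^sup>2) / (2 * t)" using pos by (simp add: field_simps)
    also have "\<dots> = (t / 2) * p\<^sup>2 + (1 / (2 * t)) * q\<^sup>2"
      using pos by (simp add: field_simps power2_eq_square)
    finally show ?thesis .
  qed
  have "cmod (\<Sum>i\<in>I. \<Sum>j\<in>J. of_real (x i * y j) * b i j)
      \<le> (\<Sum>i\<in>I. \<Sum>j\<in>J. \<bar>x i * y j\<bar> * cmod (b i j))"
    by (intro sum_norm_le) (simp add: norm_mult abs_mult)
  also have "\<dots> \<le> (\<Sum>i\<in>I. \<Sum>j\<in>J. ((t / 2) * (x i)\<^sup>2 + (1 / (2 * t)) * (y j)\<^sup>2) * cmod (b i j))"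
    by (intro sum_mono mult_right_mono *) auto
  also have "\<dots> = (t / 2) * (\<Sum>i\<in>I. \<Sum>j\<in>J. (x i)\<^sup>2 * cmod (b i j))
      + (1 / (2 * t)) * (\<Sum>j\<in>J. \<Sum>i\<in>I. (y j)\<^sup>2 * cmod (b i j))"
    by (simp add: sum.distrib sum_distrib_left algebra_simps sum.swap[of _ J I])
  also have "\<dots> \<le> (t / 2) * (4 * \<alpha>) + (1 / (2 * t)) * (4 * \<beta>)"
    by (intro add_mono mult_left_mono row_col_weighted_sum_le
        row_col_weighted_sum_le[where b = "\<lambda>j i. b i j"]) (use assms in auto)
  finally show ?thesis by (simp add: field_simps)
qed

text \<open>Pairs are sorted by the level difference \<open>d = l j - k i\<close>. Each difference
  with \<open>-m < d < n\<close> costs \<open>16 * M\<close>. For \<open>d \<le> -m\<close> the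
  coefficient of \<open>y\<close> is dominated by that of \<open>x\<close>, and the row bound
  applies; for \<open>d \<ge> n\<close> the roles are exchanged. The cut-offs \<open>m\<close>,
  \<open>n\<close> are separate because \<alpha> and \<beta> may differ greatly.\<close>

lemma dyadic_bilinear_le:
  fixes x y :: "nat \<Rightarrow> real" and b :: "nat \<Rightarrow> nat \<Rightarrow> complex" and m n :: int
  assumes x: "(\<Sum>i<N. (x i)\<^sup>2) \<le> 1" and y: "(\<Sum>j<N. (y j)\<^sup>2) \<le> 1"
    and pos: "0 \<le> M" "0 \<le> \<alpha>" "0 \<le> \<beta>"
    and bM: "\<And>S R. S \<subseteq> {..<N} \<Longrightarrow> R \<subseteq> {..<N} \<Longrightarrow>
      cmod (\<Sum>i\<in>S. \<Sum>j\<in>R. b i j) \<le> M * sqrt (real (card S) * real (card R))"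
    and row: "\<And>i R. i < N \<Longrightarrow> R \<subseteq> {..<N} \<Longrightarrow> cmod (\<Sum>j\<in>R. b i j) \<le> \<alpha>"
    and col: "\<And>j S. j < N \<Longrightarrow> S \<subseteq> {..<N} \<Longrightarrow> cmod (\<Sum>i\<in>S. b i j) \<le> \<beta>"
  shows "cmod (\<Sum>i<N. \<Sum>j<N. of_real (x i * y j) * b i j)
    \<le> 16 * M * real_of_int (max 0 (m + n)) + 8 * \<alpha> * 2 powr - real_of_int m + 8 * \<beta> * 2 powr - real_of_int n"
proof -
  \<comment> \<open>Zero coefficients are discarded first, since the dyadic level is meaningful only
    for nonzero numbers.\<close>
  define I where "I = {i. i < N \<and> x i \<noteq> 0}"
  define J where "J = {j. j < N \<and> y j \<noteq> 0}"
  define k where "k i = dyadic_level (x i)" for i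
  define l where "l j = dyadic_level (y j)" for j
  define w where "w = (\<lambda>(i, j). of_real (x i * y j) * b i j)"
  define near where "near = {p \<in> I \<times> J. l (snd p) - k (fst p) \<in> {-m<..<n}}"
  define far where "far = {p \<in> I \<times> J. l (snd p) - k (fst p) \<notin> {-m<..<n}}"
  have fin: "finite I" "finite J" "finite near" "finite far"
    and sub: "I \<subseteq> {..<N}" "J \<subseteq> {..<N}"
    by (auto simp: I_def J_def near_def far_def)
  have xI: "(\<Sum>i\<in>I. (x i)\<^sup>2) \<le> 1" and yJ: "(\<Sum>j\<in>J. (y j)\<^sup>2) \<le> 1"
    using sum_mono2[of "{..<N}" I "\<lambda>i. (x i)\<^sup>2"] sum_mono2[of "{..<N}" J "\<lambda>i. (y i)\<^sup>2"] x y sub by auto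
  have "(\<Sum>i<N. \<Sum>j<N. of_real (x i * y j) * b i j) = (\<Sum>p\<in>{..<N} \<times> {..<N}. w p)"
    by (simp add: sum.cartesian_product w_def)
  also have "\<dots> = (\<Sum>p\<in>I \<times> J. w p)"
    by (rule sum.mono_neutral_right) (auto simp: I_def J_def w_def)
  also have "\<dots> = (\<Sum>p\<in>near. w p) + (\<Sum>p\<in>far. w p)"
    by (subst sum.union_disjoint[symmetric]) (use fin in \<open>auto simp: near_def far_def intro!: sum.cong\<close>)
  finally have split: "cmod (\<Sum>i<N. \<Sum>j<N. of_real (x i * y j) * b i j)
      \<le> cmod (\<Sum>p\<in>near. w p) + cmod (\<Sum>p\<in>far. w p)"
    by (simp add: norm_triangle_ineq)

  \<comment> \<open>Recording the level difference together with the level of \<open>x i\<close>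
    makes every fibre a product of two level sets, the shape required by the estimate for a fixed
    difference.\<close>
  define g where "g p = (l (snd p) - k (fst p), k (fst p))" for p
  have "(\<Sum>p\<in>near. w p) = (\<Sum>q\<in>{-m<..<n} \<times> (k ` I). \<Sum>p | p \<in> near \<and> g p = q. w p)"
    by (rule sum.group[symmetric]) (use fin in \<open>auto simp: near_def g_def\<close>)
  also have "\<dots> = (\<Sum>d\<in>{-m<..<n}. \<Sum>k'\<in>k ` I. \<Sum>p | p \<in> near \<and> g p = (d, k'). w p)"
    by (simp add: sum.cartesian_product)
  also have "\<dots> = (\<Sum>d\<in>{-m<..<n}. \<Sum>k'\<in>k ` I. \<Sum>i | i \<in> I \<and> k i = k'. \<Sum>j | j \<in> J \<and> l j = k' + d.
      of_real (x i * y j) * b i j)"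
  proof (intro sum.cong refl)
    fix d k' assume "d \<in> {-m<..<n}"
    then have "{p \<in> near. g p = (d, k')} = {i. i \<in> I \<and> k i = k'} \<times> {j. j \<in> J \<and> l j = k' + d}"
      by (auto simp: near_def g_def)
    then show "(\<Sum>p | p \<in> near \<and> g p = (d, k'). w p) =
        (\<Sum>i | i \<in> I \<and> k i = k'. \<Sum>j | j \<in> J \<and> l j = k' + d. of_real (x i * y j) * b i j)"
      by (simp add: sum.cartesian_product w_def)
  qed
  also have "cmod \<dots> \<le> (\<Sum>d\<in>{-m<..<n}. 16 * M)"
  proof (rule sum_norm_le)
    fix d
    show "cmod (\<Sum>k'\<in>k ` I. \<Sum>i | i \<in> I \<and> k i = k'. \<Sum>j | j \<in> J \<and> l j = k' + d.
        of_real (x i * y j) * b i j) \<le> 16 * M"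
      unfolding k_def l_def
      by (rule order.trans[OF norm_sum dyadic_diagonal_le])
         (use fin xI yJ pos sub bM in \<open>auto simp: I_def J_def subset_iff\<close>)
  qed
  \<comment> \<open>The open interval contains at most \<open>max 0 (m + n)\<close> integers; the
    maximum with 0 covers the case that it is empty.\<close>
  also have "\<dots> \<le> 16 * M * real_of_int (max 0 (m + n))"
    using pos by (simp add: mult.commute mult_right_mono)
  finally have near: "cmod (\<Sum>p\<in>near. w p) \<le> 16 * M * real_of_int (max 0 (m + n))" .

  \<comment> \<open>\<open>u\<close> dominates the terms with difference at most \<open>-m\<close>,
    \<open>v\<close> those with difference at least \<open>n\<close>. The leading factor 2 is the
    ratio of the end points of a dyadic level. Both are nonnegative, so \<open>u p + v p\<close> is
    a bound in either case.\<close>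
  define u where "u p = 2 * 2 powr - m * ((x (fst p))\<^sup>2 * cmod (b (fst p) (snd p)))" for p
  define v where "v p = 2 * 2 powr - n * ((y (snd p))\<^sup>2 * cmod (b (fst p) (snd p)))" for p
  have uv: "cmod (w p) \<le> u p + v p" if "p \<in> far" for p
  proof -
    obtain i j where p: "p = (i, j)" by (cases p)
    have ij: "i \<in> I" "j \<in> J" and lk: "l j \<le> k i - m \<or> k i \<le> l j - n"
      using that by (auto simp: far_def p)
    have bi: "2 powr k i \<le> \<bar>x i\<bar>" "\<bar>x i\<bar> \<le> 2 * 2 powr k i"
      using dyadic_level_bounds[of "x i"] ij by (auto simp: k_def I_def powr_add)
    have bj: "2 powr l j \<le> \<bar>y j\<bar>" "\<bar>y j\<bar> \<le> 2 * 2 powr l j"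
      using dyadic_level_bounds[of "y j"] ij by (auto simp: l_def J_def powr_add)
    have c: "cmod (w p) = \<bar>x i\<bar> * \<bar>y j\<bar> * cmod (b i j)"
      by (simp add: w_def p norm_mult abs_mult)
    have nn: "0 \<le> u p" "0 \<le> v p" by (auto simp: u_def v_def)
    from lk show ?thesis
    proof
      assume "l j \<le> k i - m"
      then have "2 powr l j \<le> 2 powr (of_int (k i) + - of_int m)" by (intro powr_mono) auto
      also have "\<dots> \<le> \<bar>x i\<bar> * 2 powr - m"
        using bi(1) by (simp only: powr_add) (simp add: mult_right_mono)
      finally have "\<bar>y j\<bar> \<le> 2 * 2 powr - m * \<bar>x i\<bar>" using bj(2) by (simp add: mult_ac)
      then have "\<bar>x i\<bar> * \<bar>y j\<bar> * cmod (b i j) \<le> \<bar>x i\<bar> * (2 * 2 powr - m * \<bar>x i\<bar>) * cmod (b i j)"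
        by (intro mult_right_mono mult_left_mono) auto
      also have "\<dots> = u p" by (simp add: u_def p power2_eq_square)
      finally show ?thesis using c nn by simp
    next
      assume "k i \<le> l j - n"
      then have "2 powr k i \<le> 2 powr (of_int (l j) + - of_int n)" by (intro powr_mono) auto
      also have "\<dots> \<le> \<bar>y j\<bar> * 2 powr - n"
        using bj(1) by (simp only: powr_add) (simp add: mult_right_mono)
      finally have "\<bar>x i\<bar> \<le> 2 * 2 powr - n * \<bar>y j\<bar>" using bi(2) by (simp add: mult_ac)
      then have "\<bar>x i\<bar> * \<bar>y j\<bar> * cmod (b i j) \<le> (2 * 2 powr - n * \<bar>y j\<bar>) * \<bar>y j\<bar> * cmod (b i j)"
        by (intro mult_right_mono) auto
      also have "\<dots> = v p" by (simp add: v_def p power2_eq_square)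
      finally show ?thesis using c nn by simp
    qed
  qed
  have su: "(\<Sum>p\<in>I \<times> J. u p) \<le> 2 * 2 powr - m * (4 * \<alpha>)"
  proof -
    have "(\<Sum>p\<in>I \<times> J. u p) = 2 * 2 powr - m * (\<Sum>i\<in>I. \<Sum>j\<in>J. (x i)\<^sup>2 * cmod (b i j))"
      unfolding sum.cartesian_product by (simp add: u_def sum_distrib_left case_prod_beta)
    also have "\<dots> \<le> 2 * 2 powr - m * (4 * \<alpha>)"
      by (intro mult_left_mono row_col_weighted_sum_le) (use fin xI pos row sub in auto)
    finally show ?thesis .
  qed
  have sv: "(\<Sum>p\<in>I \<times> J. v p) \<le> 2 * 2 powr - n * (4 * \<beta>)"
  proof -
    have "(\<Sum>p\<in>I \<times> J. v p) = 2 * 2 powr - n * (\<Sum>i\<in>I. \<Sum>j\<in>J. (y j)\<^sup>2 * cmod (b i j))"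
      unfolding sum.cartesian_product by (simp add: v_def sum_distrib_left case_prod_beta)
    also have "(\<Sum>i\<in>I. \<Sum>j\<in>J. (y j)\<^sup>2 * cmod (b i j)) = (\<Sum>j\<in>J. \<Sum>i\<in>I. (y j)\<^sup>2 * cmod (b i j))"
      by (rule sum.swap)
    also have "2 * 2 powr - n * \<dots> \<le> 2 * 2 powr - n * (4 * \<beta>)"
      by (intro mult_left_mono row_col_weighted_sum_le[where b = "\<lambda>j i. b i j"])
         (use fin yJ pos col sub in auto)
    finally show ?thesis .
  qed
  have "cmod (\<Sum>p\<in>far. w p) \<le> (\<Sum>p\<in>far. u p + v p)"
    by (rule sum_norm_le[OF uv])
  also have "\<dots> \<le> (\<Sum>p\<in>I \<times> J. u p + v p)"
    by (rule sum_mono2) (use fin in \<open>auto simp: far_def u_def v_def\<close>)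
  also have "\<dots> \<le> 2 * 2 powr - m * (4 * \<alpha>) + 2 * 2 powr - n * (4 * \<beta>)"
    using su sv by (simp add: sum.distrib)
  finally show ?thesis using split near by (simp add: mult_ac)
qed

section \<open>The spectral theorem for Hermitian matrices\<close>

lemma mult_mat_index:
  "A \<in> carrier_mat n m \<Longrightarrow> B \<in> carrier_mat m l \<Longrightarrow> i < n \<Longrightarrow> j < l \<Longrightarrow>
    (A * B) $$ (i, j) = (\<Sum>k<m. A $$ (i, k) * B $$ (k, j))"
  by (auto simp: scalar_prod_def lessThan_atLeast0 intro!: sum.cong)

lemma mult_mat_vec_index:
  "A \<in> carrier_mat n m \<Longrightarrow> v \<in> carrier_vec m \<Longrightarrow> i < n \<Longrightarrow>
    (A *\<^sub>v v) $ i = (\<Sum>k<m. A $$ (i, k) * v $ k)"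
  by (auto simp: scalar_prod_def lessThan_atLeast0 intro!: sum.cong)

lemma adj_dim [simp]: "dim_row (adj A) = dim_col A" "dim_col (adj A) = dim_row A"
  by (auto simp: adj_def)

lemma adj_carrier [simp]: "A \<in> carrier_mat n m \<Longrightarrow> adj A \<in> carrier_mat m n"
  by auto

lemma adj_index [simp]: "i < dim_col A \<Longrightarrow> j < dim_row A \<Longrightarrow> adj A $$ (i, j) = cnj (A $$ (j, i))"
  by (auto simp: adj_def)

lemma adj_adj [simp]: "adj (adj A) = A"
  by (rule eq_matI) auto

lemma adj_mult: "A \<in> carrier_mat n m \<Longrightarrow> B \<in> carrier_mat m l \<Longrightarrow> adj (A * B) = adj B * adj A"
proof (rule eq_matI, goal_cases)
  case (1 i j)
  then have ij: "i < l" "j < n" by auto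
  have "adj (A * B) $$ (i, j) = cnj ((A * B) $$ (j, i))" using 1 ij by (subst adj_index) auto
  also have "\<dots> = (adj B * adj A) $$ (i, j)"
    using 1 ij by (simp add: mult_mat_index[of A n m B l] mult_mat_index[of "adj B" l m "adj A" n] mult.commute
      del: index_mult_mat)
  finally show ?case .
qed auto

lemma adj_add: "A \<in> carrier_mat n m \<Longrightarrow> B \<in> carrier_mat n m \<Longrightarrow> adj (A + B) = adj A + adj B"
  by (rule eq_matI) auto

lemma adj_smult: "adj (c \<cdot>\<^sub>m A) = cnj c \<cdot>\<^sub>m adj A"
  by (rule eq_matI) auto

lemma mtrace_mult_commute:
  assumes "A \<in> carrier_mat n m" "B \<in> carrier_mat m n"
  shows "mtrace (A * B) = mtrace (B * A)"
proof -
  have "mtrace (A * B) = (\<Sum>i<n. \<Sum>k<m. A $$ (i, k) * B $$ (k, i))"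
    unfolding mtrace_def using assms by (intro sum.cong mult_mat_index) auto
  also have "\<dots> = (\<Sum>k<m. \<Sum>i<n. B $$ (k, i) * A $$ (i, k))"
    by (subst sum.swap) (simp add: mult.commute)
  also have "\<dots> = mtrace (B * A)"
    unfolding mtrace_def using assms by (intro sum.cong mult_mat_index[symmetric]) auto
  finally show ?thesis .
qed

lemma hs_inner_sum:
  assumes "A \<in> carrier_mat n m" "B \<in> carrier_mat n m"
  shows "hs_inner A B = (\<Sum>i<n. \<Sum>j<m. cnj (A $$ (i, j)) * B $$ (i, j))"
proof -
  have "hs_inner A B = (\<Sum>j<m. \<Sum>i<n. adj A $$ (j, i) * B $$ (i, j))"
    unfolding hs_inner_def mtrace_def using assms by (intro sum.cong mult_mat_index) auto
  also have "\<dots> = (\<Sum>j<m. \<Sum>i<n. cnj (A $$ (i, j)) * B $$ (i, j))"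
    using assms by (intro sum.cong) auto
  also have "\<dots> = (\<Sum>i<n. \<Sum>j<m. cnj (A $$ (i, j)) * B $$ (i, j))" by (rule sum.swap)
  finally show ?thesis .
qed

lemma vinner_mult_mat_vec:
  assumes "A \<in> carrier_mat n m" "v \<in> carrier_vec n" "w \<in> carrier_vec m"
  shows "vinner v (A *\<^sub>v w) = vinner (adj A *\<^sub>v v) w"
proof -
  have "vinner v (A *\<^sub>v w) = (\<Sum>i<n. \<Sum>k<m. cnj (v $ i) * (A $$ (i, k) * w $ k))"
    unfolding vinner_def using assms
    by (intro sum.cong) (auto simp: mult_mat_vec_index sum_distrib_left simp del: index_mult_mat_vec)
  also have "\<dots> = (\<Sum>k<m. \<Sum>i<n. cnj (v $ i) * (A $$ (i, k) * w $ k))" by (rule sum.swap)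
  also have "\<dots> = vinner (adj A *\<^sub>v v) w"
    unfolding vinner_def using assms
    by (intro sum.cong) (auto simp: mult_mat_vec_index[of "adj A" m n] sum_distrib_left mult_ac
        simp del: index_mult_mat_vec)
  finally show ?thesis .
qed

lemma vinner_self: "vinner v v = of_real ((vnorm v)\<^sup>2)"
  by (simp add: vinner_def vnorm_def sum_nonneg complex_norm_square mult.commute del: of_real_power)

lemma cmod_vinner_le:
  assumes "dim_vec v = dim_vec w"
  shows "cmod (vinner v w) \<le> vnorm v * vnorm w"
proof -
  have "cmod (vinner v w) \<le> (\<Sum>i<dim_vec v. \<bar>cmod (v $ i)\<bar> * \<bar>cmod (w $ i)\<bar>)"
    unfolding vinner_def by (intro sum_norm_le) (simp add: norm_mult)
  also have "\<dots> \<le> L2_set (\<lambda>i. cmod (v $ i)) {..<dim_vec v} * L2_set (\<lambda>i. cmod (w $ i)) {..<dim_vec v}"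
    by (rule L2_set_mult_ineq)
  finally show ?thesis using assms by (simp add: vnorm_def L2_set_def)
qed

lemma vnorm_nonneg [simp]: "0 \<le> vnorm v"
  by (simp add: vnorm_def sum_nonneg)

lemma vnorm_eq_0_iff: "v \<in> carrier_vec n \<Longrightarrow> vnorm v = 0 \<longleftrightarrow> v = 0\<^sub>v n"
  by (auto simp: vnorm_def sum_nonneg_eq_0_iff)

lemma vnorm_smult: "vnorm (c \<cdot>\<^sub>v v) = cmod c * vnorm v"
  by (simp add: vnorm_def norm_mult power_mult_distrib sum_distrib_left[symmetric] real_sqrt_mult)

section \<open>Unitary matrices and functional calculus\<close>

definition unitary :: "nat \<Rightarrow> complex mat \<Rightarrow> bool" where
  "unitary n U \<longleftrightarrow> U \<in> carrier_mat n n \<and> adj U * U = 1\<^sub>m n \<and> U * adj U = 1\<^sub>m n"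

definition diag_of :: "nat \<Rightarrow> (nat \<Rightarrow> complex) \<Rightarrow> complex mat" where
  "diag_of n f = mat n n (\<lambda>(i, j). if i = j then f i else 0)"

text \<open>For unitary \<open>U\<close> with columns \<open>u_i\<close> this is the sum of
  \<open>f i\<close> times the projection onto \<open>u_i\<close>. Allowing complex \<open>f\<close>
  keeps adjoints in the same form; products multiply the functions pointwise.\<close>

definition spec_mat :: "nat \<Rightarrow> complex mat \<Rightarrow> (nat \<Rightarrow> complex) \<Rightarrow> complex mat" where
  "spec_mat n U f = U * diag_of n f * adj U"

lemma diag_of_carrier [simp]: "diag_of n f \<in> carrier_mat n n"
  by (simp add: diag_of_def)

lemma diag_of_dim [simp]: "dim_row (diag_of n f) = n" "dim_col (diag_of n f) = n"
  by (simp_all add: diag_of_def)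

lemma diag_of_index [simp]: "i < n \<Longrightarrow> j < n \<Longrightarrow> diag_of n f $$ (i, j) = (if i = j then f i else 0)"
  by (simp add: diag_of_def)

lemma diag_of_mult: "diag_of n f * diag_of n g = diag_of n (\<lambda>i. f i * g i)"
  by (rule eq_matI)
     (auto simp: mult_mat_index[of _ n n _ n] if_distrib[of "\<lambda>x. x * _"] cong: if_cong simp del: index_mult_mat(1))

lemma mult_diag_of_index:
  "A \<in> carrier_mat n n \<Longrightarrow> i < n \<Longrightarrow> j < n \<Longrightarrow> (A * diag_of n f) $$ (i, j) = A $$ (i, j) * f j"
  by (simp add: mult_mat_index[of _ n n _ n] if_distrib[of "\<lambda>x. _ * x"] cong: if_cong del: index_mult_mat(1))

lemma diag_of_mult_index:
  "A \<in> carrier_mat n n \<Longrightarrow> i < n \<Longrightarrow> j < n \<Longrightarrow> (diag_of n f * A) $$ (i, j) = f i * A $$ (i, j)"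
  by (simp add: mult_mat_index[of _ n n _ n] if_distrib[of "\<lambda>x. x * _"] cong: if_cong del: index_mult_mat(1))

lemma spec_mat_carrier [simp]: "U \<in> carrier_mat n n \<Longrightarrow> spec_mat n U f \<in> carrier_mat n n"
  by (auto simp: spec_mat_def)

lemma spec_mat_dim [simp]: "dim_row (spec_mat n U f) = dim_row U" "dim_col (spec_mat n U f) = dim_row U"
  by (auto simp: spec_mat_def)

lemma spec_mat_index:
  assumes "U \<in> carrier_mat n n" "a < n" "b < n"
  shows "spec_mat n U f $$ (a, b) = (\<Sum>i<n. f i * (U $$ (a, i) * cnj (U $$ (b, i))))"
proof -
  have "spec_mat n U f $$ (a, b) = (\<Sum>i<n. (U * diag_of n f) $$ (a, i) * adj U $$ (i, b))"
    unfolding spec_mat_def using assms by (intro mult_mat_index) auto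
  also have "\<dots> = (\<Sum>i<n. f i * (U $$ (a, i) * cnj (U $$ (b, i))))"
    using assms by (intro sum.cong) (auto simp: mult_diag_of_index simp del: index_mult_mat(1))
  finally show ?thesis .
qed

lemma adj_spec_mat: "U \<in> carrier_mat n n \<Longrightarrow> adj (spec_mat n U f) = spec_mat n U (\<lambda>i. cnj (f i))"
  by (rule eq_matI) (auto simp: spec_mat_index intro!: sum.cong simp: mult_ac)

lemma unitary_conj_spec_mat:
  assumes "unitary n U"
  shows "adj U * spec_mat n U f * U = diag_of n f"
proof -
  have U: "U \<in> carrier_mat n n" "adj U * U = 1\<^sub>m n" using assms by (auto simp: unitary_def)
  have "adj U * spec_mat n U f * U = (adj U * U) * diag_of n f * (adj U * U)"
    unfolding spec_mat_def using U(1) by (simp add: mult_carrier_mat[of _ n n _ n] assoc_mult_mat[of _ n n _ n _ n])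
  then show ?thesis using U by simp
qed

lemma spec_mat_mult:
  assumes "unitary n U"
  shows "spec_mat n U f * spec_mat n U g = spec_mat n U (\<lambda>i. f i * g i)"
proof -
  have U: "U \<in> carrier_mat n n" "adj U * U = 1\<^sub>m n" using assms by (auto simp: unitary_def)
  have "spec_mat n U f * spec_mat n U g = U * diag_of n f * (adj U * U) * (diag_of n g * adj U)"
    unfolding spec_mat_def using U(1) by (simp add: mult_carrier_mat[of _ n n _ n] assoc_mult_mat[of _ n n _ n _ n])
  also have "\<dots> = U * (diag_of n f * diag_of n g) * adj U"
    using U by (simp add: mult_carrier_mat[of _ n n _ n] assoc_mult_mat[of _ n n _ n _ n])
  finally show ?thesis by (simp add: diag_of_mult spec_mat_def)
qed

lemma mtrace_spec_mat:
  assumes "unitary n U"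
  shows "mtrace (spec_mat n U f) = (\<Sum>i<n. f i)"
proof -
  have U: "U \<in> carrier_mat n n" "adj U * U = 1\<^sub>m n" using assms by (auto simp: unitary_def)
  have "mtrace (spec_mat n U f) = mtrace (adj U * (U * diag_of n f))"
    unfolding spec_mat_def using U by (intro mtrace_mult_commute[of _ n n]) auto
  also have "adj U * (U * diag_of n f) = (adj U * U) * diag_of n f"
    using U(1) by (simp add: mult_carrier_mat[of _ n n _ n] assoc_mult_mat[of _ n n _ n _ n])
  finally show ?thesis using U by (simp add: mtrace_def)
qed

lemma unitary_mult:
  assumes "unitary n U" "unitary n V"
  shows "unitary n (U * V)"
proof -
  have U: "U \<in> carrier_mat n n" "adj U * U = 1\<^sub>m n" "U * adj U = 1\<^sub>m n"
    and V: "V \<in> carrier_mat n n" "adj V * V = 1\<^sub>m n" "V * adj V = 1\<^sub>m n"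
    using assms by (auto simp: unitary_def)
  have "adj (U * V) * (U * V) = adj V * (adj U * U) * V" "(U * V) * adj (U * V) = U * (V * adj V) * adj U"
    using U(1) V(1) by (simp_all add: adj_mult[of _ n n _ n] mult_carrier_mat[of _ n n _ n] assoc_mult_mat[of _ n n _ n _ n])
  then show ?thesis using U V by (simp add: unitary_def)
qed

section \<open>Householder reflections and diagonalisation\<close>

text \<open>The Householder reflection exchanging \<open>v\<close> and the first basis vector; the phase of
  \<open>v\<close> is normalised so that the reflection is Hermitian. If \<open>v $ 0 = 1\<close>, then \<open>c = 1 / 0 = 0\<close>
  and \<open>H\<close> is the identity.\<close>

lemma householder:
  assumes v: "v \<in> carrier_vec (Suc n)" "vnorm v = 1" "v $ 0 = of_real r"
  obtains H where "H \<in> carrier_mat (Suc n) (Suc n)" "adj H = H" "H * H = 1\<^sub>m (Suc n)" "col H 0 = v"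
proof -
  define w where "w i = v $ i - (if i = 0 then 1 else 0)" for i
  \<comment> \<open>With \<open>w = v - e_0\<close> the squared length of \<open>w\<close> is
    \<open>2 - 2 * r\<close>, so for \<open>r \<noteq> 1\<close> the constant \<open>c\<close> is 2
    over that length, as for a reflection along \<open>w\<close>.\<close>
  define c where "c = 1 / (1 - r)"
  define H where "H = mat (Suc n) (Suc n)
    (\<lambda>(i, j). (if i = j then 1 else 0) - of_real c * w i * cnj (w j))"
  have H: "H \<in> carrier_mat (Suc n) (Suc n)" by (simp add: H_def)
  have idx: "H $$ (i, j) = (if i = j then 1 else 0) - of_real c * w i * cnj (w j)"
    if "i < Suc n" "j < Suc n" for i j using that by (simp add: H_def)
  have vs: "(\<Sum>i<Suc n. cnj (v $ i) * v $ i) = 1"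
    using vinner_self[of v] v by (simp add: vinner_def)
  have w0: "w 0 = of_real (r - 1)" by (simp add: w_def v)
  have ws: "(\<Sum>i<Suc n. cnj (w i) * w i) = of_real (2 - 2 * r)"
  proof -
    have "(\<Sum>i<Suc n. cnj (w i) * w i)
        = (\<Sum>i<Suc n. cnj (v $ i) * v $ i) + (cnj (w 0) * w 0 - cnj (v $ 0) * v $ 0)"
      unfolding sum.lessThan_Suc_shift by (simp add: w_def)
    also have "\<dots> = 1 + of_real ((r - 1)\<^sup>2 - r\<^sup>2)" unfolding vs w0 v(3) by (simp add: power2_eq_square)
    also have "\<dots> = of_real (2 - 2 * r)" by (simp add: power2_eq_square algebra_simps)
    finally show ?thesis .
  qed
  \<comment> \<open>The degenerate case: for \<open>r = 1\<close> the squared length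
    \<open>2 - 2 * r\<close> vanishes, hence so does \<open>w\<close>.\<close>
  have w_zero: "w i = 0" if "r = 1" "i < Suc n" for i
  proof -
    have "(\<Sum>i<Suc n. (cmod (w i))\<^sup>2) = 0"
      using ws that(1) by (simp add: complex_norm_square[symmetric] mult.commute[of "cnj _"]
        del: sum.lessThan_Suc of_real_power flip: of_real_sum)
    then show ?thesis using that by (simp add: sum_nonneg_eq_0_iff del: sum.lessThan_Suc)
  qed
  have col: "H $$ (i, 0) = v $ i" if "i < Suc n" for i
  proof (cases "r = 1")
    case True
    then show ?thesis using w_zero[OF True that] that idx[of i 0] w_def[of i] by simp
  next
    case False
    then have "of_real c * cnj (w 0) = (-1 :: complex)" by (simp add: w0 c_def field_simps flip: of_real_diff of_real_mult)
    then have "H $$ (i, 0) = (if i = 0 then 1 else 0) + w i"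
      using idx[of i 0] that by (simp add: mult.assoc mult.left_commute[of _ "w i"])
    then show ?thesis by (simp add: w_def)
  qed
  have "(H * H) $$ (i, j) = 1\<^sub>m (Suc n) $$ (i, j)" if ij: "i < Suc n" "j < Suc n" for i j
  proof -
    let ?d = "\<lambda>i j. if i = j then 1 else (0::complex)"
    have "(H * H) $$ (i, j) = (\<Sum>k<Suc n. (?d i k - of_real c * w i * cnj (w k)) * (?d k j - of_real c * w k * cnj (w j)))"
      using ij H by (subst mult_mat_index[of _ "Suc n" "Suc n" _ "Suc n"]) (auto simp: idx simp del: sum.lessThan_Suc)
    also have "\<dots> = (\<Sum>k<Suc n. ?d i k * ?d k j - ?d i k * (of_real c * w k * cnj (w j))
        - ?d k j * (of_real c * w i * cnj (w k)) + (of_real c)\<^sup>2 * w i * cnj (w j) * (cnj (w k) * w k))"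
      by (intro sum.cong refl) (simp add: algebra_simps power2_eq_square)
    also have "\<dots> = (\<Sum>k<Suc n. ?d i k * ?d k j) - (\<Sum>k<Suc n. ?d i k * (of_real c * w k * cnj (w j)))
        - (\<Sum>k<Suc n. ?d k j * (of_real c * w i * cnj (w k)))
        + (of_real c)\<^sup>2 * w i * cnj (w j) * (\<Sum>k<Suc n. cnj (w k) * w k)"
      by (simp only: sum.distrib sum_subtractf sum_distrib_left)
    also have "\<dots> = ?d i j - of_real c * w i * cnj (w j) - of_real c * w i * cnj (w j)
        + (of_real c)\<^sup>2 * w i * cnj (w j) * of_real (2 - 2 * r)"
      unfolding ws using ij
      by (simp add: if_distrib[of "\<lambda>x. x * _"] cong: if_cong del: sum.lessThan_Suc)
    also have "\<dots> = ?d i j"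
    proof (cases "r = 1")
      case True
      then show ?thesis using w_zero[OF True ij(1)] by simp
    next
      case False
      then have "c * (2 - 2 * r) = 2" by (simp add: c_def field_simps)
      then have "of_real c * of_real (2 - 2 * r) = (2 :: complex)"
        by (simp only: of_real_mult[symmetric]) simp
      moreover have "(of_real c)\<^sup>2 * w i * cnj (w j) * of_real (2 - 2 * r)
          = of_real c * (of_real c * of_real (2 - 2 * r)) * (w i * cnj (w j))"
        by (simp only: power2_eq_square mult_ac)
      ultimately show ?thesis by (simp add: mult_ac)
    qed
    finally show ?thesis using ij by simp
  qed
  then have HH: "H * H = 1\<^sub>m (Suc n)" by (intro eq_matI) (use H in auto)
  have "adj H = H" by (rule eq_matI) (use H in \<open>auto simp: idx mult_ac\<close>)
  moreover have "col H 0 = v" by (rule eq_vecI) (use H v col in auto)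
  ultimately show ?thesis using that H HH by blast
qed

text \<open>An eigenvector may be multiplied by any nonzero scalar. The length is used to normalise
  it and the phase to make its first coordinate real, as the reflection requires.\<close>

lemma unit_eigenvector_real_head:
  assumes A: "A \<in> carrier_mat (Suc n) (Suc n)"
  obtains v k r where "v \<in> carrier_vec (Suc n)" "vnorm v = 1" "v $ 0 = of_real r" "A *\<^sub>v v = k \<cdot>\<^sub>v v"
proof -
  from spectrum_non_empty[OF A] obtain k where "eigenvalue A k"
    by (auto simp: spectrum_def)
  then obtain u where u: "u \<in> carrier_vec (Suc n)" "u \<noteq> 0\<^sub>v (Suc n)" "A *\<^sub>v u = k \<cdot>\<^sub>v u"
    using A by (auto simp: eigenvalue_def eigenvector_def)
  have n0: "vnorm u > 0" using u vnorm_eq_0_iff[OF u(1)] by (simp add: less_le)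
  \<comment> \<open>The phase turning \<open>u $ 0\<close> into its modulus; if
    \<open>u $ 0 = 0\<close>, any phase will do and 1 is taken.\<close>
  define p where "p = (if u $ 0 = 0 then 1 else cnj (u $ 0) / cmod (u $ 0))"
  have p: "cmod p = 1" "p * u $ 0 = of_real (cmod (u $ 0))"
    by (auto simp: p_def norm_divide complex_norm_square[symmetric] mult.commute[of "cnj _"] power2_eq_square)
  define q where "q = p / of_real (vnorm u)"
  show ?thesis
  proof (rule that)
    show "q \<cdot>\<^sub>v u \<in> carrier_vec (Suc n)" using u by simp
    show "vnorm (q \<cdot>\<^sub>v u) = 1" using n0 p by (simp add: vnorm_smult q_def norm_divide)
    have "(q \<cdot>\<^sub>v u) $ 0 = p * u $ 0 / vnorm u" using u by (simp add: q_def)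
    then show "(q \<cdot>\<^sub>v u) $ 0 = of_real (cmod (u $ 0) / vnorm u)" by (simp add: p)
    show "A *\<^sub>v (q \<cdot>\<^sub>v u) = k \<cdot>\<^sub>v (q \<cdot>\<^sub>v u)"
      using A u by (simp add: mult_mat_vec smult_smult_assoc mult.commute)
  qed
qed

text \<open>Hermitian symmetry transfers the vanishing of the first column below the diagonal to the
  first row, so \<open>A\<close> is block diagonal and is diagonalised by the block matrix
  \<open>V\<close> with blocks 1 and \<open>U\<close>. The corner entry is real because it equals
  its own conjugate.\<close>

lemma hermitian_deflation:
  assumes A: "A \<in> carrier_mat (Suc n) (Suc n)" and herm: "adj A = A"
    and col: "\<And>i. i < n \<Longrightarrow> A $$ (Suc i, 0) = 0"
    and U: "unitary n U" and B: "mat n n (\<lambda>(i, j). A $$ (Suc i, Suc j)) = spec_mat n U (\<lambda>i. of_real (e i))"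
  shows "\<exists>V d. unitary (Suc n) V \<and> A = spec_mat (Suc n) V (\<lambda>i. complex_of_real (d i))"
proof -
  have Uc: "U \<in> carrier_mat n n" and U1: "adj U * U = 1\<^sub>m n" and U2: "U * adj U = 1\<^sub>m n"
    using U by (auto simp: unitary_def)
  define V where "V = mat (Suc n) (Suc n) (\<lambda>(i, j). case (i, j) of (0, 0) \<Rightarrow> 1
    | (0, Suc _) \<Rightarrow> 0 | (Suc _, 0) \<Rightarrow> 0 | (Suc i, Suc j) \<Rightarrow> U $$ (i, j))"
  define d where "d = case_nat (Re (A $$ (0, 0))) e"
  have V: "V \<in> carrier_mat (Suc n) (Suc n)" by (simp add: V_def)
  have Vi: "V $$ (0, 0) = 1" "\<And>j. j < n \<Longrightarrow> V $$ (0, Suc j) = 0" "\<And>j. j < n \<Longrightarrow> V $$ (Suc j, 0) = 0"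
    "\<And>i j. i < n \<Longrightarrow> j < n \<Longrightarrow> V $$ (Suc i, Suc j) = U $$ (i, j)"
    by (auto simp: V_def)
  have cc: "cnj (A $$ (i, j)) = A $$ (j, i)" if "i < Suc n" "j < Suc n" for i j
    using that A herm adj_index[of j A i] by auto
  have A00: "A $$ (0, 0) = of_real (Re (A $$ (0, 0)))" using cc[of 0 0] by (simp add: complex_eq_iff)
  have row: "A $$ (0, Suc i) = 0" if "i < n" for i using cc[of "Suc i" 0] col[OF that] that by simp
  have o: "(\<Sum>k<n. cnj (U $$ (k, i)) * U $$ (k, j)) = (if i = j then 1 else 0)"
      "(\<Sum>k<n. U $$ (i, k) * cnj (U $$ (j, k))) = (if i = j then 1 else 0)" if "i < n" "j < n" for i j
    using that Uc arg_cong[OF U1, of "\<lambda>M. M $$ (i, j)"] arg_cong[OF U2, of "\<lambda>M. M $$ (i, j)"]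
    by (auto simp: mult_mat_index[of _ n n _ n] simp del: index_mult_mat(1))
  have s: "(\<Sum>k<n. of_real (e k) * (U $$ (i, k) * cnj (U $$ (j, k)))) = A $$ (Suc i, Suc j)"
    if "i < n" "j < n" for i j
    using that arg_cong[OF B, of "\<lambda>M. M $$ (i, j)"] Uc by (simp add: spec_mat_index)
  have "(adj V * V) $$ (i, j) = 1\<^sub>m (Suc n) $$ (i, j)" if ij: "i < Suc n" "j < Suc n" for i j
    using ij V
    by (cases i; cases j)
       (auto simp: mult_mat_index[of _ "Suc n" "Suc n" _ "Suc n"] sum.lessThan_Suc_shift Vi o
        simp del: index_mult_mat(1) sum.lessThan_Suc)
  moreover have "(V * adj V) $$ (i, j) = 1\<^sub>m (Suc n) $$ (i, j)" if ij: "i < Suc n" "j < Suc n" for i j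
    using ij V
    by (cases i; cases j)
       (auto simp: mult_mat_index[of _ "Suc n" "Suc n" _ "Suc n"] sum.lessThan_Suc_shift Vi o
        simp del: index_mult_mat(1) sum.lessThan_Suc)
  moreover have "A $$ (i, j) = spec_mat (Suc n) V (\<lambda>i. of_real (d i)) $$ (i, j)"
    if ij: "i < Suc n" "j < Suc n" for i j
    using ij V A00
    by (cases i; cases j)
       (auto simp: spec_mat_index sum.lessThan_Suc_shift Vi s d_def row col
        simp del: sum.lessThan_Suc)
  ultimately have "unitary (Suc n) V" "A = spec_mat (Suc n) V (\<lambda>i. of_real (d i))"
    unfolding unitary_def using V A by (auto intro!: eq_matI simp: spec_mat_def simp del: index_mult_mat(1))
  then show ?thesis by blast
qed

text \<open>Induction on the dimension: a reflection taking the first basis vector to an eigenvector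
  splits off one eigenvalue, the remaining block is diagonalised by the induction hypothesis, and
  the reflection is undone.\<close>

theorem hermitian_spectral:
  assumes "A \<in> carrier_mat n n" "adj A = A"
  shows "\<exists>U e. unitary n U \<and> A = spec_mat n U (\<lambda>i. complex_of_real (e i))"
  using assms
proof (induction n arbitrary: A)
  case 0
  then have "unitary 0 (1\<^sub>m 0)" "A = spec_mat 0 (1\<^sub>m 0) (\<lambda>i. of_real 0)"
    by (auto simp: unitary_def spec_mat_def intro!: eq_matI)
  then show ?case by (intro exI[of _ "1\<^sub>m 0"] exI[of _ "\<lambda>_. 0"]) simp
next
  case (Suc n)
  note A = Suc.prems(1)
  obtain v k r where v: "v \<in> carrier_vec (Suc n)" "vnorm v = 1" "v $ 0 = of_real r" "A *\<^sub>v v = k \<cdot>\<^sub>v v"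
    by (rule unit_eigenvector_real_head[OF A])
  obtain H where H: "H \<in> carrier_mat (Suc n) (Suc n)" "adj H = H" "H * H = 1\<^sub>m (Suc n)" "col H 0 = v"
    by (rule householder[OF v(1-3)])
  have HU: "unitary (Suc n) H" using H by (simp add: unitary_def)
  define A' where "A' = H * A * H"
  have A': "A' \<in> carrier_mat (Suc n) (Suc n)" using H A by (simp add: A'_def)
  have herm: "adj A' = A'"
    using H A Suc.prems(2) by (simp add: A'_def adj_mult[of _ "Suc n" "Suc n" _ "Suc n"] mult_carrier_mat[of _ "Suc n" "Suc n" _ "Suc n"] assoc_mult_mat[of _ "Suc n" "Suc n" _ "Suc n" _ "Suc n"])
  \<comment> \<open>\<open>H\<close> sends the first basis vector to \<open>v\<close> and, being an
    involution, \<open>v\<close> back to it; hence that vector is an eigenvector of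
    \<open>H * A * H\<close>.\<close>
  have "col A' 0 = (H * A) *\<^sub>v v"
    unfolding A'_def using H A by (subst col_mult2[of _ "Suc n" "Suc n" _ "Suc n"]) auto
  also have "\<dots> = H *\<^sub>v (k \<cdot>\<^sub>v v)" using H A v by (simp add: assoc_mult_mat_vec[of _ "Suc n" "Suc n" _ "Suc n"])
  also have "\<dots> = k \<cdot>\<^sub>v (H *\<^sub>v col H 0)" using H v by (simp add: mult_mat_vec)
  also have "H *\<^sub>v col H 0 = col (H * H) 0"
    using H(1) by (subst col_mult2[of _ "Suc n" "Suc n" _ "Suc n"]) auto
  finally have c: "col A' 0 = k \<cdot>\<^sub>v unit_vec (Suc n) 0" using H by simp
  have col: "A' $$ (Suc i, 0) = 0" if "i < n" for i
    using that A' arg_cong[OF c, of "\<lambda>w. w $ Suc i"] by simp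
  define B where "B = mat n n (\<lambda>(i, j). A' $$ (Suc i, Suc j))"
  have "adj B = B"
  proof (rule eq_matI)
    fix i j assume ij: "i < dim_row B" "j < dim_col B"
    then have "adj A' $$ (Suc i, Suc j) = cnj (A' $$ (Suc j, Suc i))" using A' by (simp add: B_def)
    then show "adj B $$ (i, j) = B $$ (i, j)" using ij herm by (simp add: B_def)
  qed (auto simp: B_def)
  then obtain U e where U: "unitary n U" "B = spec_mat n U (\<lambda>i. of_real (e i))"
    using Suc.IH[of B] by (auto simp: B_def)
  obtain V d where V: "unitary (Suc n) V" "A' = spec_mat (Suc n) V (\<lambda>i. of_real (d i))"
    using hermitian_deflation[OF A' herm col U(1) U(2)[unfolded B_def]] by blast
  have Vc: "V \<in> carrier_mat (Suc n) (Suc n)" using V by (simp add: unitary_def)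
  have "A = (H * H) * A * (H * H)" using H A by simp
  also have "\<dots> = H * A' * H"
    using H(1) A unfolding A'_def by (simp add: mult_carrier_mat[of _ "Suc n" "Suc n" _ "Suc n"] assoc_mult_mat[of _ "Suc n" "Suc n" _ "Suc n" _ "Suc n"])
  also have "\<dots> = spec_mat (Suc n) (H * V) (\<lambda>i. of_real (d i))"
    unfolding V(2) spec_mat_def using H(1,2) Vc
    by (simp add: adj_mult[of _ "Suc n" "Suc n" _ "Suc n"] mult_carrier_mat[of _ "Suc n" "Suc n" _ "Suc n"] assoc_mult_mat[of _ "Suc n" "Suc n" _ "Suc n" _ "Suc n"])
  finally show ?case using unitary_mult[OF HU V(1)] by blast
qed

section \<open>Schatten and operator norms\<close>

definition fro :: "complex mat \<Rightarrow> real" where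
  "fro A = L2_set (\<lambda>p. cmod (A $$ p)) ({..<dim_row A} \<times> {..<dim_col A})"

lemma fro_nonneg [simp]: "0 \<le> fro A"
  by (simp add: fro_def L2_set_nonneg)

lemma fro_square: "(fro A)\<^sup>2 = (\<Sum>i<dim_row A. \<Sum>j<dim_col A. (cmod (A $$ (i, j)))\<^sup>2)"
  by (simp add: fro_def L2_set_def sum_nonneg sum.cartesian_product)

lemma fro_eq_0_iff: "A \<in> carrier_mat n m \<Longrightarrow> fro A = 0 \<longleftrightarrow> A = 0\<^sub>m n m"
  by (auto simp: fro_def L2_set_eq_0_iff)

lemma cmod_index_le_fro: "i < dim_row A \<Longrightarrow> j < dim_col A \<Longrightarrow> cmod (A $$ (i, j)) \<le> fro A"
  unfolding fro_def by (rule member_le_L2_set[of _ "(i, j)" "\<lambda>p. cmod (A $$ p)"]) auto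

lemma fro_smult: "fro (c \<cdot>\<^sub>m A) = cmod c * fro A"
proof -
  have "fro (c \<cdot>\<^sub>m A) = L2_set (\<lambda>p. cmod c * cmod (A $$ p)) ({..<dim_row A} \<times> {..<dim_col A})"
    unfolding fro_def by (rule L2_set_cong) (auto simp: norm_mult)
  then show ?thesis by (simp add: fro_def L2_set_right_distrib)
qed

lemma fro_add_le:
  assumes "A \<in> carrier_mat n m" "B \<in> carrier_mat n m"
  shows "fro (A + B) \<le> fro A + fro B"
proof -
  have "fro (A + B) \<le> L2_set (\<lambda>p. cmod (A $$ p) + cmod (B $$ p)) ({..<n} \<times> {..<m})"
    unfolding fro_def using assms by (auto intro!: L2_set_mono norm_triangle_ineq)
  also have "\<dots> \<le> fro A + fro B" unfolding fro_def using assms by (auto intro: L2_set_triangle_ineq)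
  finally show ?thesis .
qed

lemma fro_adj [simp]: "fro (adj A) = fro A"
proof (rule power2_eq_imp_eq)
  show "(fro (adj A))\<^sup>2 = (fro A)\<^sup>2" by (simp add: fro_square) (rule sum.swap)
qed auto

lemma hs_inner_self:
  assumes "A \<in> carrier_mat n m"
  shows "hs_inner A A = of_real ((fro A)\<^sup>2)"
  unfolding hs_inner_sum[OF assms assms] fro_square using assms
  by (simp add: complex_norm_square mult.commute del: of_real_power)

lemma cmod_hs_inner_le:
  assumes "A \<in> carrier_mat n m" "B \<in> carrier_mat n m"
  shows "cmod (hs_inner A B) \<le> fro A * fro B"
proof -
  have "cmod (hs_inner A B) \<le> (\<Sum>p\<in>{..<n} \<times> {..<m}. \<bar>cmod (A $$ p)\<bar> * \<bar>cmod (B $$ p)\<bar>)"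
    unfolding hs_inner_sum[OF assms] sum.cartesian_product
    by (intro sum_norm_le) (auto simp: norm_mult)
  also have "\<dots> \<le> fro A * fro B" unfolding fro_def using assms L2_set_mult_ineq[of "\<lambda>p. cmod (A $$ p)" "\<lambda>p. cmod (B $$ p)" "{..<n} \<times> {..<m}"] by simp
  finally show ?thesis .
qed

lemma hs_inner_commute:
  assumes "A \<in> carrier_mat n m" "B \<in> carrier_mat n m"
  shows "hs_inner A B = cnj (hs_inner B A)"
  using assms by (simp add: hs_inner_sum[of _ n m] mult.commute)

lemma hs_inner_add_right:
  assumes "A \<in> carrier_mat n m" "B \<in> carrier_mat n m" "C \<in> carrier_mat n m"
  shows "hs_inner A (B + C) = hs_inner A B + hs_inner A C"
  using assms by (simp add: hs_inner_sum[of _ n m] distrib_left sum.distrib)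

lemma hs_inner_smult_right:
  assumes "A \<in> carrier_mat n m" "B \<in> carrier_mat n m"
  shows "hs_inner A (c \<cdot>\<^sub>m B) = c * hs_inner A B"
  using assms by (simp add: hs_inner_sum[of _ n m] sum_distrib_left mult_ac)

lemma adj_mult_index:
  assumes "A \<in> carrier_mat n m" "B \<in> carrier_mat n l" "i < m" "j < l"
  shows "(adj A * B) $$ (i, j) = vinner (col A i) (col B j)"
  using assms by (auto simp: mult_mat_index[of _ m n _ l] vinner_def simp del: index_mult_mat(1))

section \<open>Positive semidefinite matrices, square roots and singular values\<close>

lemma spec_mat_nonneg_psd:
  assumes U: "unitary n U" and s: "\<And>i. i < n \<Longrightarrow> 0 \<le> s i"
  shows "psd (spec_mat n U (\<lambda>i. complex_of_real (s i)))"
proof -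
  have Uc: "U \<in> carrier_mat n n" using U by (simp add: unitary_def)
  have "0 \<le> Re (vinner v (spec_mat n U (\<lambda>i. of_real (s i)) *\<^sub>v v))" if v: "v \<in> carrier_vec n" for v
  proof -
    \<comment> \<open>In the coordinates \<open>w\<close> with respect to the columns of
      \<open>U\<close> the quadratic form becomes a sum of squares with weights
      \<open>s i\<close>.\<close>
    define w where "w = adj U *\<^sub>v v"
    let ?D = "diag_of n (\<lambda>i. complex_of_real (s i))"
    have w: "w \<in> carrier_vec n" using Uc by (intro carrier_vecI) (simp add: w_def)
    have Dw: "?D *\<^sub>v w \<in> carrier_vec n" by (intro carrier_vecI) simp
    have Di: "(?D *\<^sub>v w) $ i = of_real (s i) * w $ i" if "i < n" for i
      using that w
      by (simp add: mult_mat_vec_index[of _ n n] if_distrib[of "\<lambda>x. x * _"] cong: if_cong del: index_mult_mat_vec)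
    have "spec_mat n U (\<lambda>i. of_real (s i)) *\<^sub>v v = U *\<^sub>v (?D *\<^sub>v w)"
      unfolding spec_mat_def w_def using Uc v
      by (simp add: assoc_mult_mat_vec[of _ n n _ n] mult_carrier_mat[of _ n n _ n] mult_mat_vec_carrier[of _ n n])
    then have "vinner v (spec_mat n U (\<lambda>i. of_real (s i)) *\<^sub>v v) = vinner w (?D *\<^sub>v w)"
      using vinner_mult_mat_vec[OF Uc v Dw] by (simp add: w_def)
    also have "\<dots> = (\<Sum>i<n. cnj (w $ i) * (of_real (s i) * w $ i))"
      unfolding vinner_def using w Di by (intro sum.cong) auto
    also have "\<dots> = of_real (\<Sum>i<n. s i * (cmod (w $ i))\<^sup>2)"
      unfolding of_real_sum by (intro sum.cong refl) (simp add: complex_norm_square mult_ac del: of_real_power)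
    finally show ?thesis using s by (auto intro!: sum_nonneg)
  qed
  then show ?thesis using Uc adj_spec_mat[OF Uc, of "\<lambda>i. of_real (s i)"] by (simp add: psd_def)
qed

text \<open>Testing the quadratic form on the \<open>i\<close>-th column of \<open>U\<close> returns
  \<open>e i\<close>.\<close>

lemma psd_spec_mat_nonneg:
  assumes U: "unitary n U" and p: "psd (spec_mat n U (\<lambda>i. complex_of_real (e i)))" and i: "i < n"
  shows "0 \<le> e i"
proof -
  let ?A = "spec_mat n U (\<lambda>i. complex_of_real (e i))"
  have Uc: "U \<in> carrier_mat n n" using U by (simp add: unitary_def)
  have A: "?A \<in> carrier_mat n n" using Uc by simp
  have "of_real (e i) = (adj U * ?A * U) $$ (i, i)" using i by (simp add: unitary_conj_spec_mat[OF U])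
  also have "adj U * ?A * U = adj U * (?A * U)" using Uc A by (simp add: assoc_mult_mat[of _ n n _ n _ n])
  also have "(adj U * (?A * U)) $$ (i, i) = vinner (col U i) (?A *\<^sub>v col U i)"
    using Uc A i by (subst adj_mult_index[of _ n n _ n]) (auto simp: col_mult2[of _ n n _ n])
  finally have "e i = Re (vinner (col U i) (?A *\<^sub>v col U i))" by (metis Re_complex_of_real)
  then show ?thesis using p Uc i by (auto simp: psd_def)
qed

text \<open>If \<open>B\<close>, \<open>C\<close> have spectral data \<open>(U, b)\<close>, \<open>(V, c)\<close>, then \<open>B * B = C * C\<close> says that
  \<open>W = U\<^sup>* V\<close> satisfies \<open>(b\<^sub>i\<^sup>2 - c\<^sub>j\<^sup>2) W\<^sub>i\<^sub>j = 0\<close>, and for nonnegative \<open>b\<close>, \<open>c\<close> this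
  gives \<open>b\<^sub>i W\<^sub>i\<^sub>j = W\<^sub>i\<^sub>j c\<^sub>j\<close>.\<close>

lemma psd_sqrt_unique:
  assumes B: "B \<in> carrier_mat n n" "psd B" and C: "C \<in> carrier_mat n n" "psd C" and eq: "B * B = C * C"
  shows "B = C"
proof -
  obtain U b where U: "unitary n U" and Bs: "B = spec_mat n U (\<lambda>i. complex_of_real (b i))"
    using hermitian_spectral[of B n] B by (auto simp: psd_def)
  obtain V c where V: "unitary n V" and Cs: "C = spec_mat n V (\<lambda>i. complex_of_real (c i))"
    using hermitian_spectral[of C n] C by (auto simp: psd_def)
  have b: "0 \<le> b i" and c: "0 \<le> c i" if "i < n" for i
    using psd_spec_mat_nonneg[OF U _ that] psd_spec_mat_nonneg[OF V _ that] B C Bs Cs by auto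
  have Uc: "U \<in> carrier_mat n n" "adj U * U = 1\<^sub>m n" "U * adj U = 1\<^sub>m n"
    and Vc: "V \<in> carrier_mat n n" "adj V * V = 1\<^sub>m n" "V * adj V = 1\<^sub>m n"
    using U V by (auto simp: unitary_def)
  note asc = mult_carrier_mat[of _ n n _ n] assoc_mult_mat[of _ n n _ n _ n]
  define W where "W = adj U * V"
  have W: "W \<in> carrier_mat n n" using Uc Vc by (simp add: W_def asc)
  have L: "adj U * spec_mat n U f * V = diag_of n f * W" for f
  proof -
    have "adj U * spec_mat n U f * V = (adj U * U) * (diag_of n f * W)"
      unfolding spec_mat_def W_def using Uc(1) Vc(1) by (simp add: asc)
    then show ?thesis using Uc W by (simp add: asc)
  qed
  have R: "adj U * spec_mat n V f * V = W * diag_of n f" for f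
  proof -
    have "adj U * spec_mat n V f * V = (W * diag_of n f) * (adj V * V)"
      unfolding spec_mat_def W_def using Uc(1) Vc(1) by (simp add: asc)
    then show ?thesis using Vc W by (simp add: asc)
  qed
  have sq: "diag_of n (\<lambda>i. of_real (b i) * of_real (b i)) * W = W * diag_of n (\<lambda>i. of_real (c i) * of_real (c i))"
    unfolding L[symmetric] R[symmetric] using eq by (simp add: Bs Cs spec_mat_mult[OF U] spec_mat_mult[OF V])
  have "diag_of n (\<lambda>i. of_real (b i)) * W = W * diag_of n (\<lambda>i. of_real (c i))"
  proof (rule eq_matI)
    fix i j assume "i < dim_row (W * diag_of n (\<lambda>i. complex_of_real (c i)))" "j < dim_col (W * diag_of n (\<lambda>i. complex_of_real (c i)))"
    then have ij: "i < n" "j < n" using W by auto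
    have "of_real (b i) * of_real (b i) * W $$ (i, j) = W $$ (i, j) * (of_real (c j) * of_real (c j))"
      using arg_cong[OF sq, of "\<lambda>M. M $$ (i, j)"] ij W
      by (simp only: diag_of_mult_index mult_diag_of_index)
    then have "W $$ (i, j) = 0 \<or> of_real (b i * b i) = (of_real (c j * c j) :: complex)" by (simp add: mult.commute)
    then have "W $$ (i, j) = 0 \<or> b i * b i = c j * c j" by (simp only: of_real_eq_iff)
    then have "W $$ (i, j) = 0 \<or> b i = c j"
      using b[OF ij(1)] c[OF ij(2)] by (metis power2_eq_square power2_eq_imp_eq)
    then show "(diag_of n (\<lambda>i. of_real (b i)) * W) $$ (i, j) = (W * diag_of n (\<lambda>i. of_real (c i))) $$ (i, j)"
      using ij W by (auto simp: diag_of_mult_index mult_diag_of_index simp del: index_mult_mat(1))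
  qed (use W in auto)
  then have e: "adj U * B * V = adj U * C * V" by (simp add: L R Bs Cs)
  have "B = (U * adj U) * B * (V * adj V)" using Uc Vc B by simp
  also have "\<dots> = U * (adj U * B * V) * adj V" using Uc(1) Vc(1) B(1) by (simp add: asc)
  also have "\<dots> = (U * adj U) * C * (V * adj V)" unfolding e using Uc(1) Vc(1) C(1) by (simp add: asc)
  also have "\<dots> = C" using Uc Vc C by simp
  finally show ?thesis .
qed

text \<open>Uniqueness of the positive square root resolves the definite description in
  \<open>mat_abs\<close>: exhibiting one root determines the value.\<close>

lemma mat_abs_eqI:
  assumes "A \<in> carrier_mat n n" "B \<in> carrier_mat n n" "psd B" "B * B = adj A * A"
  shows "mat_abs A = B"
  unfolding mat_abs_def
proof (rule the_equality)
  fix C assume C: "C \<in> carrier_mat (dim_col A) (dim_col A) \<and> psd C \<and> C * C = adj A * A"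
  show "C = B" by (rule psd_sqrt_unique[of _ n]) (use C assms in auto)
qed (use assms in auto)

text \<open>\<open>adj A * A\<close> is positive because its quadratic form is the squared norm of
  \<open>A *\<^sub>v v\<close>. Roots of its eigenvalues, in the same eigenbasis, give the absolute
  value, so one unitary \<open>U\<close> serves both matrices.\<close>

lemma singular_values:
  assumes A: "A \<in> carrier_mat n n"
  obtains U s where "unitary n U" "\<forall>i<n. 0 \<le> s i"
    "mat_abs A = spec_mat n U (\<lambda>i. complex_of_real (s i))"
    "adj A * A = spec_mat n U (\<lambda>i. complex_of_real ((s i)\<^sup>2))"
proof -
  have AA: "adj A * A \<in> carrier_mat n n" "adj (adj A * A) = adj A * A"
    using A by (auto simp: adj_mult[of _ n n _ n])
  have p: "psd (adj A * A)"
    unfolding psd_def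
  proof (intro conjI ballI AA(2))
    fix v :: "complex vec" assume "v \<in> carrier_vec (dim_col (adj A * A))"
    then have v: "v \<in> carrier_vec n" using A by simp
    then have "(adj A * A) *\<^sub>v v = adj A *\<^sub>v (A *\<^sub>v v)" using A by (simp add: assoc_mult_mat_vec[of _ n n _ n])
    then have "vinner v ((adj A * A) *\<^sub>v v) = vinner (A *\<^sub>v v) (A *\<^sub>v v)"
      using A v by (simp add: vinner_mult_mat_vec[of _ n n])
    then show "0 \<le> Re (vinner v ((adj A * A) *\<^sub>v v))" by (simp add: vinner_self)
  qed auto
  obtain U e where U: "unitary n U" and e: "adj A * A = spec_mat n U (\<lambda>i. complex_of_real (e i))"
    using hermitian_spectral[OF AA] by blast
  \<comment> \<open>For \<open>i < n\<close> the modulus changes nothing. It keeps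
    \<open>s i\<close> nonnegative at larger indices, where \<open>e\<close> is arbitrary.\<close>
  define s where "s i = sqrt \<bar>e i\<bar>" for i
  have e0: "0 \<le> e i" if "i < n" for i using psd_spec_mat_nonneg[OF U _ that] p e by auto
  have Uc: "U \<in> carrier_mat n n" using U by (simp add: unitary_def)
  have 2: "adj A * A = spec_mat n U (\<lambda>i. complex_of_real ((s i)\<^sup>2))"
    unfolding e by (rule eq_matI) (use Uc e0 in \<open>auto simp: spec_mat_index s_def intro!: sum.cong simp del: of_real_power\<close>)
  have "mat_abs A = spec_mat n U (\<lambda>i. complex_of_real (s i))"
    by (rule mat_abs_eqI[OF A])
       (use Uc U in \<open>auto simp: 2 spec_mat_mult power2_eq_square s_def intro!: spec_mat_nonneg_psd simp del: real_sqrt_mult_self\<close>)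
  with U 2 show ?thesis by (intro that[of U s]) (auto simp: s_def)
qed

section \<open>Comparison of the norms and Hoelder's inequality\<close>

lemma schatten_2_eq_fro:
  assumes A: "A \<in> carrier_mat n n"
  shows "schatten 2 A = fro A"
proof -
  obtain U s where U: "unitary n U" and s: "mat_abs A = spec_mat n U (\<lambda>i. complex_of_real (s i))"
    "adj A * A = spec_mat n U (\<lambda>i. complex_of_real ((s i)\<^sup>2))"
    using singular_values[OF A] by metis
  have "spec_mat n U (\<lambda>i. of_real (s i)) \<in> carrier_mat n n" using U by (simp add: unitary_def)
  then have "mat_abs A ^\<^sub>m 2 = adj A * A"
    by (simp add: s numeral_2_eq_2 spec_mat_mult[OF U])
  then have "Re (mtrace (mat_abs A ^\<^sub>m 2)) = (fro A)\<^sup>2"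
    using hs_inner_self[OF A] by (simp add: hs_inner_def del: of_real_power)
  then show ?thesis by (simp add: schatten_def powr_half_sqrt)
qed

lemma schatten_1_singular_values:
  assumes "unitary n U" "\<forall>i<n. 0 \<le> s i" "mat_abs A = spec_mat n U (\<lambda>i. complex_of_real (s i))"
  shows "schatten 1 A = (\<Sum>i<n. s i)"
proof -
  have "mat_abs A \<in> carrier_mat n n" using assms by (simp add: unitary_def)
  then have "Re (mtrace (mat_abs A ^\<^sub>m 1)) = (\<Sum>i<n. s i)" using assms by (simp add: mtrace_spec_mat)
  then show ?thesis using sum_nonneg[of "{..<n}" s] assms(2) by (simp add: schatten_def)
qed

lemma fro_singular_values:
  assumes A: "A \<in> carrier_mat n n" and U: "unitary n U"
    and s: "adj A * A = spec_mat n U (\<lambda>i. complex_of_real ((s i)\<^sup>2))"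
  shows "(fro A)\<^sup>2 = (\<Sum>i<n. (s i)\<^sup>2)"
proof -
  have "complex_of_real ((fro A)\<^sup>2) = of_real (\<Sum>i<n. (s i)\<^sup>2)"
    using hs_inner_self[OF A] s mtrace_spec_mat[OF U, of "\<lambda>i. complex_of_real ((s i)\<^sup>2)"]
    by (simp add: hs_inner_def del: of_real_power)
  then show ?thesis by (simp only: of_real_eq_iff)
qed

lemma fro_le_schatten_1:
  assumes A: "A \<in> carrier_mat n n"
  shows "fro A \<le> schatten 1 A"
proof -
  obtain U s where U: "unitary n U" "\<forall>i<n. 0 \<le> s i"
    "mat_abs A = spec_mat n U (\<lambda>i. complex_of_real (s i))"
    "adj A * A = spec_mat n U (\<lambda>i. complex_of_real ((s i)\<^sup>2))"
    by (rule singular_values[OF A])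
  have "fro A = L2_set s {..<n}"
    using fro_singular_values[OF A U(1,4)] by (simp add: L2_set_def real_sqrt_unique)
  also have "\<dots> \<le> (\<Sum>i<n. s i)" by (rule L2_set_le_sum) (use U in auto)
  finally show ?thesis using schatten_1_singular_values[OF U(1-3)] by simp
qed

text \<open>Each singular value is at most their \<open>l^2\<close> norm. The dimensional factor
  only serves to make the suprema of \<open>map_norm\<close> finite and does not enter the universal
  constant.\<close>

lemma schatten_1_le_fro:
  assumes A: "A \<in> carrier_mat n n"
  shows "schatten 1 A \<le> real n * fro A"
proof -
  obtain U s where U: "unitary n U" "\<forall>i<n. 0 \<le> s i"
    "mat_abs A = spec_mat n U (\<lambda>i. complex_of_real (s i))"
    "adj A * A = spec_mat n U (\<lambda>i. complex_of_real ((s i)\<^sup>2))"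
    by (rule singular_values[OF A])
  have f: "fro A = L2_set s {..<n}"
    using fro_singular_values[OF A U(1,4)] by (simp add: L2_set_def real_sqrt_unique)
  have "(\<Sum>i<n. s i) \<le> (\<Sum>i<n. fro A)"
    unfolding f by (intro sum_mono member_le_L2_set) auto
  then show ?thesis using schatten_1_singular_values[OF U(1-3)] by simp
qed

lemma vnorm_mult_mat_vec_le_fro:
  assumes A: "A \<in> carrier_mat n n" and v: "v \<in> carrier_vec n"
  shows "vnorm (A *\<^sub>v v) \<le> fro A * vnorm v"
proof -
  have "(vnorm (A *\<^sub>v v))\<^sup>2 = (\<Sum>i<n. (cmod (\<Sum>j<n. A $$ (i, j) * v $ j))\<^sup>2)"
    using A v by (simp add: vnorm_def sum_nonneg mult_mat_vec_index[of _ n n] del: index_mult_mat_vec)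
  also have "\<dots> \<le> (\<Sum>i<n. (\<Sum>j<n. (cmod (A $$ (i, j)))\<^sup>2) * (\<Sum>j<n. (cmod (v $ j))\<^sup>2))"
  proof (rule sum_mono)
    fix i
    have "cmod (\<Sum>j<n. A $$ (i, j) * v $ j) \<le> (\<Sum>j<n. \<bar>cmod (A $$ (i, j))\<bar> * \<bar>cmod (v $ j)\<bar>)"
      by (intro sum_norm_le) (simp add: norm_mult)
    also have "\<dots> \<le> L2_set (\<lambda>j. cmod (A $$ (i, j))) {..<n} * L2_set (\<lambda>j. cmod (v $ j)) {..<n}"
      by (rule L2_set_mult_ineq)
    finally have "(cmod (\<Sum>j<n. A $$ (i, j) * v $ j))\<^sup>2
        \<le> (L2_set (\<lambda>j. cmod (A $$ (i, j))) {..<n} * L2_set (\<lambda>j. cmod (v $ j)) {..<n})\<^sup>2"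
      by (intro power_mono) auto
    then show "(cmod (\<Sum>j<n. A $$ (i, j) * v $ j))\<^sup>2
        \<le> (\<Sum>j<n. (cmod (A $$ (i, j)))\<^sup>2) * (\<Sum>j<n. (cmod (v $ j))\<^sup>2)"
      by (simp add: L2_set_def power_mult_distrib sum_nonneg)
  qed
  also have "\<dots> = (fro A * vnorm v)\<^sup>2"
    using A v by (simp add: power_mult_distrib fro_square vnorm_def sum_nonneg sum_distrib_right)
  finally show ?thesis by (rule power2_le_imp_le) simp
qed

lemma bdd_above_op_norm_set:
  assumes A: "A \<in> carrier_mat n n"
  shows "bdd_above {vnorm (A *\<^sub>v v) / vnorm v | v. v \<in> carrier_vec (dim_col A) \<and> v \<noteq> 0\<^sub>v (dim_col A)}"
proof (rule bdd_aboveI[of _ "fro A"], clarify)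
  fix v :: "complex vec" assume v: "v \<in> carrier_vec (dim_col A)" "v \<noteq> 0\<^sub>v (dim_col A)"
  then have "0 < vnorm v" using vnorm_eq_0_iff[OF v(1)] by (simp add: less_le)
  then show "vnorm (A *\<^sub>v v) / vnorm v \<le> fro A"
    using vnorm_mult_mat_vec_le_fro[OF A, of v] v A by (simp add: field_simps)
qed

lemma vnorm_le_op_norm:
  assumes A: "A \<in> carrier_mat n n" and v: "v \<in> carrier_vec n"
  shows "vnorm (A *\<^sub>v v) \<le> op_norm A * vnorm v"
proof (cases "v = 0\<^sub>v n")
  case True
  then show ?thesis using vnorm_mult_mat_vec_le_fro[OF A v] vnorm_eq_0_iff[OF v] by simp
next
  case False
  then have "0 < vnorm v" using vnorm_eq_0_iff[OF v] by (simp add: less_le)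
  moreover have "vnorm (A *\<^sub>v v) / vnorm v \<le> op_norm A"
    unfolding op_norm_def by (rule cSup_upper[OF _ bdd_above_op_norm_set[OF A]]) (use False v A in auto)
  ultimately show ?thesis by (simp add: field_simps)
qed

text \<open>Positive dimension makes the set of quotients nonempty, so that its supremum is a least
  upper bound.\<close>

lemma op_norm_leI:
  assumes A: "A \<in> carrier_mat n n" and n: "0 < n"
    and c: "\<And>v. v \<in> carrier_vec n \<Longrightarrow> vnorm (A *\<^sub>v v) \<le> c * vnorm v"
  shows "op_norm A \<le> c"
  unfolding op_norm_def
proof (rule cSup_least)
  have "unit_vec n 0 \<in> carrier_vec n" "unit_vec n 0 \<noteq> (0\<^sub>v n :: complex vec)" using n by auto
  then show "{vnorm (A *\<^sub>v v) / vnorm v | v. v \<in> carrier_vec (dim_col A) \<and> v \<noteq> 0\<^sub>v (dim_col A)} \<noteq> {}"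
    using A by blast
next
  fix x assume "x \<in> {vnorm (A *\<^sub>v v) / vnorm v | v. v \<in> carrier_vec (dim_col A) \<and> v \<noteq> 0\<^sub>v (dim_col A)}"
  then obtain v where v: "x = vnorm (A *\<^sub>v v) / vnorm v" "v \<in> carrier_vec n" "v \<noteq> 0\<^sub>v n" using A by auto
  then have "0 < vnorm v" using vnorm_eq_0_iff[OF v(2)] by (simp add: less_le)
  then show "x \<le> c" using c[OF v(2)] by (simp add: v(1) field_simps)
qed

lemma op_norm_le_fro:
  assumes A: "A \<in> carrier_mat n n" and n: "0 < n"
  shows "op_norm A \<le> fro A"
  by (rule op_norm_leI[OF A n vnorm_mult_mat_vec_le_fro[OF A]])

text \<open>Every entry is a coordinate of the image of a basis vector, hence bounded by the
  operator norm; there are \<open>n * n\<close> entries. Again only finiteness of suprema depends on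
  this factor.\<close>

lemma fro_le_op_norm:
  assumes A: "A \<in> carrier_mat n n" and n: "0 < n"
  shows "fro A \<le> real n * real n * op_norm A"
proof -
  have "cmod (A $$ (i, j)) \<le> op_norm A" if ij: "i < n" "j < n" for i j
  proof -
    have u: "unit_vec n j \<in> carrier_vec n" by simp
    have "A *\<^sub>v unit_vec n j = col A j" using A ij by (intro eq_vecI) auto
    then have "cmod (A $$ (i, j)) = cmod ((A *\<^sub>v unit_vec n j) $ i)" using A ij by simp
    also have "\<dots> \<le> vnorm (A *\<^sub>v unit_vec n j)"
    proof -
      have "vnorm (A *\<^sub>v unit_vec n j) = L2_set (\<lambda>i. cmod ((A *\<^sub>v unit_vec n j) $ i)) {..<n}"
        using A by (simp add: vnorm_def L2_set_def)
      then show ?thesis using member_le_L2_set[of "{..<n}" i "\<lambda>i. cmod ((A *\<^sub>v unit_vec n j) $ i)"] ij by simp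
    qed
    also have "\<dots> \<le> op_norm A * vnorm (unit_vec n j)" by (rule vnorm_le_op_norm[OF A u])
    also have "vnorm (unit_vec n j) = 1"
      using ij by (simp add: vnorm_def unit_vec_def if_distrib[of "\<lambda>x. (cmod x)\<^sup>2"] cong: if_cong)
    finally show ?thesis by simp
  qed
  then have "(\<Sum>p\<in>{..<n} \<times> {..<n}. cmod (A $$ p)) \<le> (\<Sum>p\<in>{..<n} \<times> {..<n}. op_norm A)"
    by (intro sum_mono) auto
  moreover have "fro A \<le> (\<Sum>p\<in>{..<n} \<times> {..<n}. cmod (A $$ p))"
    unfolding fro_def using A by (auto intro: L2_set_le_sum)
  ultimately show ?thesis by simp
qed

text \<open>The trace is computed in the basis of right singular vectors \<open>u_i\<close> of
  \<open>A\<close>. Each diagonal term is the inner product of \<open>A u_i\<close>, of length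
  \<open>s i\<close>, with \<open>B u_i\<close>, of length at most \<open>op_norm B\<close>.\<close>

lemma holder_schatten_1_op_norm:
  assumes A: "A \<in> carrier_mat n n" and B: "B \<in> carrier_mat n n"
  shows "cmod (hs_inner A B) \<le> schatten 1 A * op_norm B"
proof -
  obtain U s where U: "unitary n U" "\<forall>i<n. 0 \<le> s i"
    "mat_abs A = spec_mat n U (\<lambda>i. complex_of_real (s i))"
    "adj A * A = spec_mat n U (\<lambda>i. complex_of_real ((s i)\<^sup>2))"
    by (rule singular_values[OF A])
  have Uc: "U \<in> carrier_mat n n" "adj U * U = 1\<^sub>m n" "U * adj U = 1\<^sub>m n" using U(1) by (auto simp: unitary_def)
  note asc = mult_carrier_mat[of _ n n _ n] assoc_mult_mat[of _ n n _ n _ n]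
  have conj: "(adj U * (adj A * X) * U) $$ (i, i) = vinner (A *\<^sub>v col U i) (X *\<^sub>v col U i)"
    if X: "X \<in> carrier_mat n n" and i: "i < n" for X i
  proof -
    have "adj U * (adj A * X) * U = adj (A * U) * (X * U)"
      using Uc(1) A X by (simp add: adj_mult[of _ n n _ n] asc)
    moreover have "(adj (A * U) * (X * U)) $$ (i, i) = vinner (col (A * U) i) (col (X * U) i)"
      using Uc(1) A X i by (intro adj_mult_index[of _ n n _ n]) auto
    moreover have "col (A * U) i = A *\<^sub>v col U i" "col (X * U) i = X *\<^sub>v col U i"
      using Uc(1) A X i by (auto intro: col_mult2[of _ n n _ n])
    ultimately show ?thesis by simp
  qed
  have nu: "vnorm (col U i) = 1" if i: "i < n" for i
  proof -
    have "of_real ((vnorm (col U i))\<^sup>2) = (adj U * U) $$ (i, i)"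
      using Uc(1) i by (simp add: vinner_self adj_mult_index[of _ n n _ n] del: of_real_power index_mult_mat(1))
    then have "(complex_of_real (vnorm (col U i)))\<^sup>2 = of_real 1" using Uc i by simp
    then have "(vnorm (col U i))\<^sup>2 = 1" by (simp only: of_real_power[symmetric] of_real_eq_iff)
    then show ?thesis using vnorm_nonneg[of "col U i"] by (simp add: power2_eq_1_iff)
  qed
  \<comment> \<open>The squared length is a diagonal entry of \<open>adj A * A\<close> in its own
    eigenbasis.\<close>
  have nA: "vnorm (A *\<^sub>v col U i) = s i" if i: "i < n" for i
  proof -
    have "of_real ((vnorm (A *\<^sub>v col U i))\<^sup>2) = (adj U * (adj A * A) * U) $$ (i, i)"
      using conj[OF A i] by (simp add: vinner_self)
    also have "\<dots> = of_real ((s i)\<^sup>2)" unfolding U(4) unitary_conj_spec_mat[OF U(1)] using i by simp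
    finally have "(vnorm (A *\<^sub>v col U i))\<^sup>2 = (s i)\<^sup>2" by (simp only: of_real_eq_iff)
    then show ?thesis using U(2)[rule_format, OF i] by simp
  qed
  have "hs_inner A B = mtrace ((adj A * B) * (U * adj U))"
    using A B Uc by (simp add: hs_inner_def asc)
  also have "(adj A * B) * (U * adj U) = ((adj A * B) * U) * adj U" using A B Uc(1) by (simp add: asc)
  also have "mtrace \<dots> = mtrace (adj U * ((adj A * B) * U))"
    using A B Uc(1) by (intro mtrace_mult_commute[of _ n n]) (auto simp: asc)
  also have "adj U * ((adj A * B) * U) = adj U * (adj A * B) * U" using A B Uc(1) by (simp add: asc)
  also have "mtrace \<dots> = (\<Sum>i<n. vinner (A *\<^sub>v col U i) (B *\<^sub>v col U i))"
    unfolding mtrace_def using Uc(1) by (intro sum.cong) (auto simp: conj[OF B] simp del: index_mult_mat(1))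
  also have "cmod \<dots> \<le> (\<Sum>i<n. s i * op_norm B)"
  proof (rule sum_norm_le)
    fix i assume "i \<in> {..<n}"
    then have i: "i < n" by simp
    have "cmod (vinner (A *\<^sub>v col U i) (B *\<^sub>v col U i)) \<le> vnorm (A *\<^sub>v col U i) * vnorm (B *\<^sub>v col U i)"
      by (rule cmod_vinner_le) (use A B in auto)
    also have "\<dots> \<le> s i * (op_norm B * vnorm (col U i))"
      unfolding nA[OF i] using U(2)[rule_format, OF i] Uc(1)
      by (intro mult_left_mono vnorm_le_op_norm[OF B]) auto
    finally show "cmod (vinner (A *\<^sub>v col U i) (B *\<^sub>v col U i)) \<le> s i * op_norm B" by (simp add: nu[OF i])
  qed
  finally show ?thesis using schatten_1_singular_values[OF U(1-3)] by (simp add: sum_distrib_right)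
qed

section \<open>Orthogonal projections\<close>

lemma orth_proj_vinner:
  assumes "orth_proj n P" "v \<in> carrier_vec n"
  shows "vinner v (P *\<^sub>v v) = of_real ((vnorm (P *\<^sub>v v))\<^sup>2)"
proof -
  have P: "P \<in> carrier_mat n n" "adj P = P" "P * P = P" using assms by (auto simp: orth_proj_def)
  have Pv: "P *\<^sub>v v \<in> carrier_vec n" using P assms by simp
  have "P *\<^sub>v v = P *\<^sub>v (P *\<^sub>v v)" using P assms assoc_mult_mat_vec[of P n n P n v] by simp
  then have "vinner v (P *\<^sub>v v) = vinner (P *\<^sub>v v) (P *\<^sub>v v)"
    using vinner_mult_mat_vec[OF P(1) assms(2) Pv] P(2) by simp
  then show ?thesis by (simp add: vinner_self)
qed

lemma orth_proj_mat_abs: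
  assumes "orth_proj n P"
  shows "mat_abs P = P"
proof (rule mat_abs_eqI)
  show "psd P" using assms orth_proj_vinner[OF assms] by (auto simp: psd_def orth_proj_def)
qed (use assms in \<open>auto simp: orth_proj_def\<close>)

text \<open>\<open>adj P * P = P\<close>, so the trace is the squared Hilbert--Schmidt norm; in
  particular it is nonnegative.\<close>

lemma orth_proj_mtrace:
  assumes "orth_proj n P"
  shows "Re (mtrace P) = (fro P)\<^sup>2"
proof -
  have "hs_inner P P = mtrace P" using assms by (simp add: hs_inner_def orth_proj_def)
  then show ?thesis using hs_inner_self[of P n n] assms by (simp add: orth_proj_def)
qed

lemma orth_proj_schatten_1:
  assumes "orth_proj n P"
  shows "schatten 1 P = Re (mtrace P)"
proof -
  have "P \<in> carrier_mat n n" using assms by (simp add: orth_proj_def)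
  then have "P ^\<^sub>m 1 = P" by simp
  then show ?thesis
    using orth_proj_mtrace[OF assms] by (simp add: schatten_def orth_proj_mat_abs[OF assms])
qed

text \<open>The square of the length of \<open>P *\<^sub>v v\<close> is its inner product with
  \<open>v\<close>; Cauchy--Schwarz followed by cancellation of one factor gives the bound.\<close>

lemma orth_proj_op_norm_le:
  assumes "orth_proj n P" "0 < n"
  shows "op_norm P \<le> 1"
proof (rule op_norm_leI[OF _ assms(2)])
  show P: "P \<in> carrier_mat n n" using assms by (simp add: orth_proj_def)
  fix v :: "complex vec" assume v: "v \<in> carrier_vec n"
  have "(vnorm (P *\<^sub>v v))\<^sup>2 = cmod (vinner v (P *\<^sub>v v))"
    using orth_proj_vinner[OF assms(1) v] by (simp add: norm_power)
  also have "\<dots> \<le> vnorm v * vnorm (P *\<^sub>v v)" by (rule cmod_vinner_le) (use P v in auto)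
  finally have "vnorm (P *\<^sub>v v) * vnorm (P *\<^sub>v v) \<le> vnorm v * vnorm (P *\<^sub>v v)" by (simp add: power2_eq_square)
  then show "vnorm (P *\<^sub>v v) \<le> 1 * vnorm v"
    using vnorm_nonneg[of v] vnorm_nonneg[of "P *\<^sub>v v"] unfolding mult_le_cancel_right by linarith
qed

section \<open>Linear maps on matrices\<close>

text \<open>One notion covers entries of \<open>T X\<close>, pairings of \<open>T X\<close> with a
  fixed matrix, and pairings of \<open>X\<close> itself, so expansions in matrix units or rank-one
  projections are proved once.\<close>

definition lin_functional :: "nat \<Rightarrow> (complex mat \<Rightarrow> complex) \<Rightarrow> bool" where
  "lin_functional N \<phi> \<longleftrightarrow>
     (\<forall>X \<in> carrier_mat N N. \<forall>Y \<in> carrier_mat N N. \<phi> (X + Y) = \<phi> X + \<phi> Y) \<and>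
     (\<forall>c. \<forall>X \<in> carrier_mat N N. \<phi> (c \<cdot>\<^sub>m X) = c * \<phi> X)"

lemma lin_functional_sum:
  assumes \<phi>: "lin_functional N \<phi>" and S: "finite S" and F: "\<And>k. F k \<in> carrier_mat N N"
  shows "\<phi> (mat N N (\<lambda>(a, b). \<Sum>k\<in>S. c k * F k $$ (a, b))) = (\<Sum>k\<in>S. c k * \<phi> (F k))"
  using S
proof (induction S rule: finite_induct)
  case empty
  have z: "mat N N (\<lambda>(a, b). \<Sum>k\<in>{}. c k * F k $$ (a, b)) = 0 \<cdot>\<^sub>m 0\<^sub>m N N" by (rule eq_matI) auto
  have "\<phi> (0 \<cdot>\<^sub>m 0\<^sub>m N N) = 0 * \<phi> (0\<^sub>m N N)"
    using \<phi> unfolding lin_functional_def by (meson zero_carrier_mat)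
  then show ?case unfolding z by simp
next
  case (insert k S)
  let ?X = "mat N N (\<lambda>(a, b). \<Sum>k\<in>S. c k * F k $$ (a, b))"
  have z: "mat N N (\<lambda>(a, b). \<Sum>k\<in>insert k S. c k * F k $$ (a, b)) = c k \<cdot>\<^sub>m F k + ?X"
    using insert.hyps F[of k] by (intro eq_matI) auto
  have "\<phi> (c k \<cdot>\<^sub>m F k + ?X) = c k * \<phi> (F k) + \<phi> ?X"
    using \<phi> F[of k] unfolding lin_functional_def by simp
  then show ?case unfolding z using insert by simp
qed

text \<open>Expansion in the matrix units \<open>E p\<close>, whose coefficients are entries of
  \<open>X\<close> and so at most \<open>fro X\<close>.\<close>

lemma lin_functional_bounded:
  assumes \<phi>: "lin_functional N \<phi>"
  obtains K where "0 \<le> K" "\<forall>X \<in> carrier_mat N N. cmod (\<phi> X) \<le> K * fro X"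
proof -
  define E where "E p = mat N N (\<lambda>q. if q = p then 1 else (0 :: complex))" for p
  define K where "K = (\<Sum>p\<in>{..<N} \<times> {..<N}. cmod (\<phi> (E p)))"
  have "cmod (\<phi> X) \<le> K * fro X" if X: "X \<in> carrier_mat N N" for X
  proof -
    have "X = mat N N (\<lambda>(a, b). \<Sum>p\<in>{..<N} \<times> {..<N}. X $$ p * E p $$ (a, b))"
      using X by (intro eq_matI) (auto simp: E_def if_distrib[of "\<lambda>x. _ * x"] cong: if_cong)
    then have "\<phi> X = (\<Sum>p\<in>{..<N} \<times> {..<N}. X $$ p * \<phi> (E p))"
      using lin_functional_sum[OF \<phi>, of "{..<N} \<times> {..<N}" E "\<lambda>p. X $$ p"] by (simp add: E_def)
    also have "cmod \<dots> \<le> (\<Sum>p\<in>{..<N} \<times> {..<N}. fro X * cmod (\<phi> (E p)))"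
      by (rule sum_norm_le) (use X cmod_index_le_fro[of _ X] in \<open>auto simp: norm_mult intro!: mult_right_mono\<close>)
    finally show ?thesis by (simp add: K_def sum_distrib_left mult.commute)
  qed
  then show ?thesis by (intro that[of K]) (auto simp: K_def sum_nonneg)
qed

lemma lin_functional_hs_inner_map:
  assumes T: "lin_map N T" and Z: "Z \<in> carrier_mat N N"
  shows "lin_functional N (\<lambda>X. hs_inner Z (T X))"
  using T Z by (auto simp: lin_functional_def lin_map_def hs_inner_add_right[of _ N N] hs_inner_smult_right[of _ N N])

lemma lin_functional_hs_inner:
  "Z \<in> carrier_mat N N \<Longrightarrow> lin_functional N (hs_inner Z)"
  by (auto simp: lin_functional_def hs_inner_add_right[of _ N N] hs_inner_smult_right[of _ N N])

lemma lin_map_zero: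
  assumes "lin_map N T"
  shows "T (0\<^sub>m N N) = 0\<^sub>m N N"
proof -
  have T: "T (0\<^sub>m N N) \<in> carrier_mat N N" "T (0 \<cdot>\<^sub>m 0\<^sub>m N N) = 0 \<cdot>\<^sub>m T (0\<^sub>m N N)"
    using assms unfolding lin_map_def by (meson zero_carrier_mat)+
  have "0 \<cdot>\<^sub>m 0\<^sub>m N N = (0\<^sub>m N N :: complex mat)" "0 \<cdot>\<^sub>m T (0\<^sub>m N N) = 0\<^sub>m N N"
    using T(1) by (auto intro!: eq_matI)
  then show ?thesis using T(2) by simp
qed

lemma lin_map_bounded:
  assumes T: "lin_map N T"
  obtains K where "0 \<le> K" "\<forall>X \<in> carrier_mat N N. fro (T X) \<le> K * fro X"
proof -
  have TX: "T X \<in> carrier_mat N N" if "X \<in> carrier_mat N N" for X using T that by (simp add: lin_map_def)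
  have "\<exists>K\<ge>0. \<forall>X \<in> carrier_mat N N. cmod (T X $$ p) \<le> K * fro X" if "p \<in> {..<N} \<times> {..<N}" for p
  proof -
    have "lin_functional N (\<lambda>X. T X $$ p)"
      using T that TX unfolding lin_functional_def lin_map_def
      by (auto simp: carrier_matD[OF TX])
    then show ?thesis using lin_functional_bounded by metis
  qed
  then obtain k where k: "\<And>p. p \<in> {..<N} \<times> {..<N} \<Longrightarrow> 0 \<le> k p \<and> (\<forall>X \<in> carrier_mat N N. cmod (T X $$ p) \<le> k p * fro X)"
    by metis
  have "fro (T X) \<le> (\<Sum>p\<in>{..<N} \<times> {..<N}. k p) * fro X" if X: "X \<in> carrier_mat N N" for X
  proof -
    have "fro (T X) \<le> (\<Sum>p\<in>{..<N} \<times> {..<N}. cmod (T X $$ p))"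
      unfolding fro_def using TX[OF X] by (auto intro: L2_set_le_sum)
    also have "\<dots> \<le> (\<Sum>p\<in>{..<N} \<times> {..<N}. k p * fro X)" using k X by (intro sum_mono) blast
    finally show ?thesis by (simp add: sum_distrib_right)
  qed
  moreover have "0 \<le> (\<Sum>p\<in>{..<N} \<times> {..<N}. k p)" using k by (intro sum_nonneg) blast
  ultimately show ?thesis using that by blast
qed

text \<open>Two-sided comparison of \<open>nrm\<close> with \<open>fro\<close> makes the supremum in
  \<open>map_norm\<close> finite, so it bounds every quotient; a quotient with \<open>T X\<close>
  nonzero is positive. The instances are the Schatten norms 1 and 2 and the operator norm.\<close>

lemma map_norm_equivalent_norm:
  assumes T: "lin_map N T" and k: "0 < k1" "0 \<le> k2"
    and n1: "\<And>X. X \<in> carrier_mat N N \<Longrightarrow> fro X \<le> k1 * nrm X"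
    and n2: "\<And>X. X \<in> carrier_mat N N \<Longrightarrow> nrm X \<le> k2 * fro X"
  shows map_norm_upper: "X \<in> carrier_mat N N \<Longrightarrow> nrm (T X) \<le> map_norm nrm N T * nrm X"
    and map_norm_pos: "X \<in> carrier_mat N N \<Longrightarrow> T X \<noteq> 0\<^sub>m N N \<Longrightarrow> 0 < map_norm nrm N T"
proof -
  let ?S = "{nrm (T X) / nrm X | X. X \<in> carrier_mat N N \<and> X \<noteq> 0\<^sub>m N N}"
  have TX: "T X \<in> carrier_mat N N" if "X \<in> carrier_mat N N" for X using T that by (simp add: lin_map_def)
  have pos: "0 < nrm X" if X: "X \<in> carrier_mat N N" "X \<noteq> 0\<^sub>m N N" for X
  proof -
    have "0 < fro X" using fro_eq_0_iff[OF X(1)] X(2) by (simp add: less_le)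
    then have "0 < k1 * nrm X" using n1[OF X(1)] by simp
    then show ?thesis using k by (simp add: zero_less_mult_iff)
  qed
  have f0: "fro (0\<^sub>m N N) = 0" using fro_eq_0_iff[of "0\<^sub>m N N" N N] by simp
  \<comment> \<open>The zero matrix is excluded from the supremum, so the upper bound there rests on
    both sides being 0.\<close>
  have z: "nrm (0\<^sub>m N N) = 0"
    using n1[of "0\<^sub>m N N"] n2[of "0\<^sub>m N N"] f0 k by (simp add: zero_le_mult_iff)
  obtain K where K: "0 \<le> K" "\<forall>X \<in> carrier_mat N N. fro (T X) \<le> K * fro X" by (rule lin_map_bounded[OF T])
  note T0 = lin_map_zero[OF T]
  have bdd: "bdd_above ?S"
  proof (rule bdd_aboveI[of _ "k2 * (K * k1)"], clarify)
    fix X :: "complex mat" assume X: "X \<in> carrier_mat N N" "X \<noteq> 0\<^sub>m N N"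
    have "nrm (T X) \<le> k2 * fro (T X)" by (rule n2[OF TX[OF X(1)]])
    also have "\<dots> \<le> k2 * (K * (k1 * nrm X))"
      using K X n1[OF X(1)] k by (intro mult_left_mono order.trans[OF K(2)[rule_format, OF X(1)]]) auto
    finally show "nrm (T X) / nrm X \<le> k2 * (K * k1)" using pos[OF X] by (simp add: field_simps)
  qed
  have up: "nrm (T X) / nrm X \<le> map_norm nrm N T" if "X \<in> carrier_mat N N" "X \<noteq> 0\<^sub>m N N" for X
    unfolding map_norm_def by (rule cSup_upper[OF _ bdd]) (use that in auto)
  show "nrm (T X) \<le> map_norm nrm N T * nrm X" if X: "X \<in> carrier_mat N N"
  proof (cases "X = 0\<^sub>m N N")
    case True
    then show ?thesis by (simp add: T0 z)
  next
    case False
    then show ?thesis using up[OF X False] pos[OF X False] by (simp add: field_simps)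
  qed
  show "0 < map_norm nrm N T" if X: "X \<in> carrier_mat N N" "T X \<noteq> 0\<^sub>m N N"
  proof -
    have "X \<noteq> 0\<^sub>m N N" using X T0 by auto
    then have "0 < nrm (T X) / nrm X" using pos[OF X(1)] pos[OF TX[OF X(1)] X(2)] by simp
    then show ?thesis using up[OF X(1) \<open>X \<noteq> 0\<^sub>m N N\<close>] by simp
  qed
qed

section \<open>Near-extremal Hermitian matrices and spectral projections\<close>

lemma fro_hermitian_spec_mat:
  assumes U: "unitary n U"
  shows "(fro (spec_mat n U (\<lambda>i. complex_of_real (x i))))\<^sup>2 = (\<Sum>i<n. (x i)\<^sup>2)"
proof -
  let ?A = "spec_mat n U (\<lambda>i. complex_of_real (x i))"
  have Uc: "U \<in> carrier_mat n n" using U by (simp add: unitary_def)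
  have "adj ?A * ?A = spec_mat n U (\<lambda>i. complex_of_real ((x i)\<^sup>2))"
    using adj_spec_mat[OF Uc, of "\<lambda>i. complex_of_real (x i)"] by (simp add: spec_mat_mult[OF U] power2_eq_square)
  then show ?thesis using Uc by (intro fro_singular_values[OF _ U]) auto
qed

text \<open>One of the Hermitian matrices \<open>(X + adj X) / 2\<close> and
  \<open>(X - adj X) / (2 * \<i>)\<close> carries at least half of the value of the functional, and
  neither has larger norm than \<open>X\<close>.\<close>

lemma hermitian_part_dominates:
  assumes \<phi>: "lin_functional N \<phi>" and X: "X \<in> carrier_mat N N"
  obtains H where "H \<in> carrier_mat N N" "adj H = H" "fro H \<le> fro X" "cmod (\<phi> X) \<le> 2 * cmod (\<phi> H)"
proof -
  define H where "H c = c \<cdot>\<^sub>m X + cnj c \<cdot>\<^sub>m adj X" for c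
  have H: "H c \<in> carrier_mat N N" "adj (H c) = H c" for c
    using X by (auto simp: H_def adj_add[of _ N N] adj_smult comm_add_mat[of _ N N])
  have f: "fro (H c) \<le> fro X" if "cmod c = 1 / 2" for c
    using fro_add_le[of "c \<cdot>\<^sub>m X" N N "cnj c \<cdot>\<^sub>m adj X"] X that by (simp add: H_def fro_smult)
  have "X = H (1 / 2) + \<i> \<cdot>\<^sub>m H (- \<i> / 2)"
    using X by (intro eq_matI) (auto simp: H_def field_simps)
  then have "\<phi> X = \<phi> (H (1 / 2)) + \<i> * \<phi> (H (- \<i> / 2))"
    using \<phi> H unfolding lin_functional_def by (metis smult_carrier_mat)
  then have "cmod (\<phi> X) \<le> cmod (\<phi> (H (1 / 2))) + cmod (\<phi> (H (- \<i> / 2)))"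
    using norm_triangle_ineq[of "\<phi> (H (1 / 2))" "\<i> * \<phi> (H (- \<i> / 2))"] by (simp add: norm_mult)
  then have "cmod (\<phi> X) \<le> 2 * cmod (\<phi> (H (1 / 2))) \<or> cmod (\<phi> X) \<le> 2 * cmod (\<phi> (H (- \<i> / 2)))" by linarith
  then show ?thesis using that H f by (metis norm_divide norm_ii norm_minus_cancel norm_one norm_numeral)
qed

text \<open>The constant 8 is one factor 2 for choosing \<open>X\<close> below the supremum and one
  for each passage to a Hermitian matrix. Strictness is kept, since the strict lower bound of the
  theorem comes from here.\<close>

lemma near_extremal_hermitian_pair:
  assumes T: "lin_map N T" and ne: "X0 \<in> carrier_mat N N" "T X0 \<noteq> 0\<^sub>m N N"
  defines "l \<equiv> map_norm (schatten 2) N T"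
  obtains H K where "H \<in> carrier_mat N N" "adj H = H" "fro H \<le> 1"
    "K \<in> carrier_mat N N" "adj K = K" "fro K \<le> 1" "l / 8 < cmod (hs_inner K (T H))"
proof -
  have TX: "T X \<in> carrier_mat N N" if "X \<in> carrier_mat N N" for X using T that by (simp add: lin_map_def)
  have s2: "schatten 2 X = fro X" if "X \<in> carrier_mat N N" for X by (rule schatten_2_eq_fro[OF that])
  have l: "0 < l" unfolding l_def
    by (rule map_norm_pos[OF T, of 1 1]) (use s2 ne in auto)
  have "X0 \<noteq> 0\<^sub>m N N" using ne lin_map_zero[OF T] by auto
  define Z where "Z = {schatten 2 (T X) / schatten 2 X | X. X \<in> carrier_mat N N \<and> X \<noteq> 0\<^sub>m N N}"
  have "Z \<noteq> {}" using ne \<open>X0 \<noteq> 0\<^sub>m N N\<close> unfolding Z_def by blast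
  moreover have "l / 2 < Sup Z" using l by (simp add: l_def map_norm_def Z_def)
  ultimately obtain q where "q \<in> Z" and q: "l / 2 < q" by (metis less_cSupD)
  then obtain X where X: "X \<in> carrier_mat N N" "X \<noteq> 0\<^sub>m N N"
    and "q = schatten 2 (T X) / schatten 2 X"
    by (auto simp: Z_def)
  with q have lX: "l / 2 < fro (T X) / fro X" by (simp add: s2 TX)
  have fX: "0 < fro X" using fro_eq_0_iff[OF X(1)] X(2) by (simp add: less_le)
  define X' where "X' = of_real (1 / fro X) \<cdot>\<^sub>m X"
  have X': "X' \<in> carrier_mat N N" "fro X' = 1" using X fX by (simp_all add: X'_def fro_smult norm_divide)
  have "T X' = of_real (1 / fro X) \<cdot>\<^sub>m T X" using T X by (simp add: X'_def lin_map_def)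
  then have fT: "l / 2 < fro (T X')" using lX fX by (simp add: fro_smult norm_divide)
  then have fT0: "0 < fro (T X')" using l by simp
  \<comment> \<open>The normalised image of \<open>X'\<close> turns the norm of \<open>T X'\<close>
    into an inner product, to which the reduction to Hermitian matrices applies in either
    argument.\<close>
  define Y where "Y = of_real (1 / fro (T X')) \<cdot>\<^sub>m T X'"
  have Y: "Y \<in> carrier_mat N N" "fro Y = 1" using TX[OF X'(1)] fT0 by (simp_all add: Y_def fro_smult norm_divide)
  have "hs_inner (T X') Y = of_real (1 / fro (T X')) * of_real ((fro (T X'))\<^sup>2)"
    unfolding Y_def by (simp only: hs_inner_smult_right[OF TX[OF X'(1)] TX[OF X'(1)]] hs_inner_self[OF TX[OF X'(1)]])
  also have "\<dots> = of_real (fro (T X'))" using fT0 by (simp add: power2_eq_square)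
  finally have "cmod (hs_inner (T X') Y) = fro (T X')" using fT0 by simp
  then have YX: "cmod (hs_inner Y (T X')) = fro (T X')"
    using hs_inner_commute[OF Y(1) TX[OF X'(1)]] by simp
  obtain H where H: "H \<in> carrier_mat N N" "adj H = H" "fro H \<le> fro X'"
    "cmod (hs_inner Y (T X')) \<le> 2 * cmod (hs_inner Y (T H))"
    by (rule hermitian_part_dominates[OF lin_functional_hs_inner_map[OF T Y(1)] X'(1)])
  obtain K where K: "K \<in> carrier_mat N N" "adj K = K" "fro K \<le> fro Y"
    "cmod (hs_inner (T H) Y) \<le> 2 * cmod (hs_inner (T H) K)"
    by (rule hermitian_part_dominates[OF lin_functional_hs_inner[OF TX[OF H(1)]] Y(1)])
  have "cmod (hs_inner Y (T H)) = cmod (hs_inner (T H) Y)" "cmod (hs_inner K (T H)) = cmod (hs_inner (T H) K)"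
    using hs_inner_commute[OF Y(1) TX[OF H(1)]] hs_inner_commute[OF K(1) TX[OF H(1)]] by simp_all
  then have "l / 8 < cmod (hs_inner K (T H))" using H(4) K(4) YX fT by simp
  then show ?thesis using that[OF H(1,2) _ K(1,2)] H(3) K(3) X'(2) Y(2) by simp
qed

text \<open>The projection onto the span of the columns of \<open>U\<close> with index in
  \<open>S\<close>; singletons give the rank-one spectral projections.\<close>

definition spec_proj :: "nat \<Rightarrow> complex mat \<Rightarrow> nat set \<Rightarrow> complex mat" where
  "spec_proj N U S = spec_mat N U (\<lambda>i. complex_of_real (if i \<in> S then 1 else 0))"

lemma orth_proj_spec_proj:
  assumes U: "unitary N U"
  shows "orth_proj N (spec_proj N U S)"
proof -
  have Uc: "U \<in> carrier_mat N N" using U by (simp add: unitary_def)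
  have "(\<lambda>i. complex_of_real (if i \<in> S then 1 else 0) * complex_of_real (if i \<in> S then 1 else 0))
      = (\<lambda>i. complex_of_real (if i \<in> S then 1 else 0))" by auto
  then show ?thesis using Uc adj_spec_mat[OF Uc, of "\<lambda>i. complex_of_real (if i \<in> S then 1 else 0)"]
    by (simp add: orth_proj_def spec_proj_def spec_mat_mult[OF U])
qed

lemma mtrace_spec_proj:
  assumes "unitary N U" "S \<subseteq> {..<N}"
  shows "mtrace (spec_proj N U S) = of_nat (card S)"
proof -
  have "{..<N} \<inter> S = S" using assms by auto
  then show ?thesis
    by (simp add: spec_proj_def mtrace_spec_mat[OF assms(1)] if_distrib[of complex_of_real] sum.If_cases)
qed

lemma lin_functional_spec_mat:
  assumes \<phi>: "lin_functional N \<phi>" and U: "unitary N U"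
  shows "\<phi> (spec_mat N U f) = (\<Sum>i<N. f i * \<phi> (spec_proj N U {i}))"
proof -
  have Uc: "U \<in> carrier_mat N N" using U by (simp add: unitary_def)
  have F: "spec_proj N U {i} \<in> carrier_mat N N" for i using Uc by (simp add: spec_proj_def)
  have idx: "spec_proj N U {i} $$ (a, b) = U $$ (a, i) * cnj (U $$ (b, i))" if "i < N" "a < N" "b < N" for i a b
    using that Uc by (simp add: spec_proj_def spec_mat_index if_distrib[of complex_of_real] if_distrib[of "\<lambda>x. x * _"] cong: if_cong)
  have "spec_mat N U f = mat N N (\<lambda>(a, b). \<Sum>i<N. f i * spec_proj N U {i} $$ (a, b))"
    using Uc by (intro eq_matI) (auto simp: spec_mat_index idx)
  then show ?thesis using lin_functional_sum[OF \<phi> _ F, of "{..<N}" f] by simp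
qed

text \<open>The pairing is conjugate-linear in its first argument, so that expansion passes through
  \<open>hs_inner_commute\<close>; the coefficients \<open>y j\<close> are real and survive
  conjugation.\<close>

lemma hs_inner_spec_mats:
  assumes T: "lin_map N T" and U: "unitary N U" and V: "unitary N V"
  shows "hs_inner (spec_mat N V (\<lambda>j. of_real (y j))) (T (spec_mat N U (\<lambda>i. of_real (x i))))
    = (\<Sum>i<N. \<Sum>j<N. of_real (x i * y j) * hs_inner (spec_proj N V {j}) (T (spec_proj N U {i})))"
proof -
  let ?K = "spec_mat N V (\<lambda>j. complex_of_real (y j))"
  have Uc: "U \<in> carrier_mat N N" "V \<in> carrier_mat N N" using U V by (simp_all add: unitary_def)
  have K: "?K \<in> carrier_mat N N" using Uc by simp
  have P: "T (spec_proj N U {i}) \<in> carrier_mat N N" and Q: "spec_proj N V {i} \<in> carrier_mat N N" for i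
    using T Uc by (simp_all add: lin_map_def spec_proj_def)
  have "hs_inner ?K (T (spec_proj N U {i})) = (\<Sum>j<N. of_real (y j) * hs_inner (spec_proj N V {j}) (T (spec_proj N U {i})))" for i
  proof -
    have "hs_inner ?K (T (spec_proj N U {i})) = cnj (\<Sum>j<N. of_real (y j) * hs_inner (T (spec_proj N U {i})) (spec_proj N V {j}))"
      using hs_inner_commute[OF K P] lin_functional_spec_mat[OF lin_functional_hs_inner[OF P] V] by simp
    then show ?thesis using hs_inner_commute[OF Q P] by simp
  qed
  then show ?thesis
    using lin_functional_spec_mat[OF lin_functional_hs_inner_map[OF T K] U, of "\<lambda>i. of_real (x i)"]
    by (simp add: sum_distrib_left mult.assoc)
qed

lemma hs_inner_spec_projs:
  assumes T: "lin_map N T" and U: "unitary N U" and V: "unitary N V" and SR: "S \<subseteq> {..<N}" "R \<subseteq> {..<N}"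
  shows "hs_inner (spec_proj N V R) (T (spec_proj N U S))
    = (\<Sum>i\<in>S. \<Sum>j\<in>R. hs_inner (spec_proj N V {j}) (T (spec_proj N U {i})))"
proof -
  have "hs_inner (spec_proj N V R) (T (spec_proj N U S))
    = (\<Sum>i<N. \<Sum>j<N. of_real ((if i \<in> S then 1 else 0) * (if j \<in> R then 1 else 0)) * hs_inner (spec_proj N V {j}) (T (spec_proj N U {i})))"
    using hs_inner_spec_mats[OF T U V, of "\<lambda>j. if j \<in> R then 1 else 0" "\<lambda>i. if i \<in> S then 1 else 0"]
    by (simp only: spec_proj_def)
  also have "\<dots> = (\<Sum>i\<in>S. \<Sum>j<N. of_real ((if i \<in> S then 1 else 0) * (if j \<in> R then 1 else 0)) * hs_inner (spec_proj N V {j}) (T (spec_proj N U {i})))"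
    by (rule sum.mono_neutral_right) (use SR in auto)
  also have "\<dots> = (\<Sum>i\<in>S. \<Sum>j\<in>R. of_real ((if i \<in> S then 1 else 0) * (if j \<in> R then 1 else 0)) * hs_inner (spec_proj N V {j}) (T (spec_proj N U {i})))"
    by (intro sum.cong refl sum.mono_neutral_right) (use SR in auto)
  also have "\<dots> = (\<Sum>i\<in>S. \<Sum>j\<in>R. hs_inner (spec_proj N V {j}) (T (spec_proj N U {i})))"
    by (intro sum.cong refl) auto
  finally show ?thesis .
qed

text \<open>Finitely many pairs of nonempty subsets compete, so the largest ratio is attained, and
  the maximising pair later supplies the two projections. For an empty subset both sides of the
  final bound are 0.\<close>

lemma max_subset_ratio:
  fixes b :: "nat \<Rightarrow> nat \<Rightarrow> complex"
  assumes N: "0 < N"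
  obtains S R M where "S \<subseteq> {..<N}" "S \<noteq> {}" "R \<subseteq> {..<N}" "R \<noteq> {}" "0 \<le> M"
    "M = cmod (\<Sum>i\<in>S. \<Sum>j\<in>R. b i j) / sqrt (real (card S) * real (card R))"
    "\<forall>S' R'. S' \<subseteq> {..<N} \<longrightarrow> R' \<subseteq> {..<N} \<longrightarrow>
      cmod (\<Sum>i\<in>S'. \<Sum>j\<in>R'. b i j) \<le> M * sqrt (real (card S') * real (card R'))"
proof -
  define F where "F = {S. S \<subseteq> {..<N} \<and> S \<noteq> {}}"
  define g where "g p = cmod (\<Sum>i\<in>fst p. \<Sum>j\<in>snd p. b i j) / sqrt (real (card (fst p)) * real (card (snd p)))" for p
  have "finite F" by (rule finite_subset[of _ "Pow {..<N}"]) (auto simp: F_def)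
  then have fin: "finite (g ` (F \<times> F))" by simp
  have "{0} \<in> F" using N by (auto simp: F_def)
  then have ne: "g ` (F \<times> F) \<noteq> {}" by auto
  define M where "M = Max (g ` (F \<times> F))"
  obtain S R where SR: "S \<in> F" "R \<in> F" "M = g (S, R)" using Max_in[OF fin ne] by (auto simp: M_def)
  have "cmod (\<Sum>i\<in>S'. \<Sum>j\<in>R'. b i j) \<le> M * sqrt (real (card S') * real (card R'))"
    if s: "S' \<subseteq> {..<N}" "R' \<subseteq> {..<N}" for S' R'
  proof (cases "S' = {} \<or> R' = {}")
    case True
    then show ?thesis by auto
  next
    case False
    then have "g (S', R') \<le> M" unfolding M_def using s by (intro Max_ge[OF fin]) (auto simp: F_def)
    moreover have "0 < card S'" "0 < card R'" using False s finite_subset[OF _ finite_lessThan] by (auto simp: card_gt_0_iff)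
    ultimately show ?thesis by (simp add: g_def field_simps)
  qed
  moreover have "0 \<le> M" by (simp add: SR(3) g_def)
  ultimately show ?thesis using that[of S R M] SR by (simp add: F_def g_def)
qed

section \<open>Numerical estimates and the final constant\<close>

lemma ceiling_log_powr_le:
  assumes "0 < a"
  shows "a * 2 powr - \<lceil>log 2 a\<rceil> \<le> 1"
proof -
  have "a = 2 powr (log 2 a)" using assms by simp
  also have "\<dots> \<le> 2 powr (of_int \<lceil>log 2 a\<rceil>)" by (intro powr_mono) auto
  finally show ?thesis by (simp add: powr_minus field_simps)
qed

text \<open>The cut-offs are chosen so that the far terms take only half of \<open>l / 8\<close>.
  The near terms then exceed \<open>l / 16\<close>, while the number of level differences is
  \<open>O(log h) + O(1)\<close>; the Schur bound keeps \<open>h\<close> away from 0, so that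
  \<open>ln (h + 1)\<close> absorbs the constant.\<close>

lemma ratio_lower_bound:
  fixes l \<alpha> \<beta> M :: real
  assumes pos: "0 < l" "0 < \<alpha>" "0 < \<beta>" "0 \<le> M"
    and schur: "\<And>t. 0 < t \<Longrightarrow> l / 8 < 2 * (t * \<alpha> + \<beta> / t)"
    and dyadic: "\<And>m n :: int. l / 8 < 16 * M * real_of_int (max 0 (m + n)) + 8 * \<alpha> * 2 powr - real_of_int m + 8 * \<beta> * 2 powr - real_of_int n"
  shows "l / (153600 * ln (sqrt (\<alpha> * \<beta>) / l + 1)) < M"
proof -
  define h where "h = sqrt (\<alpha> * \<beta>) / l"
  \<comment> \<open>The balancing choice \<open>t = sqrt \<beta> / sqrt \<alpha>\<close> makes both
    terms equal to \<open>sqrt (\<alpha> * \<beta>)\<close>.\<close>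
  have "l / 8 < 2 * (sqrt \<beta> / sqrt \<alpha> * \<alpha> + \<beta> / (sqrt \<beta> / sqrt \<alpha>))" using pos by (intro schur) auto
  also have "sqrt \<beta> / sqrt \<alpha> * \<alpha> = sqrt (\<alpha> * \<beta>)"
    using pos by (simp add: real_sqrt_mult field_simps)
  also have "\<beta> / (sqrt \<beta> / sqrt \<alpha>) = sqrt (\<alpha> * \<beta>)"
    using pos by (simp add: real_sqrt_mult field_simps)
  finally have h: "1 / 32 < h" using pos by (simp add: h_def field_simps)
  define L where "L = ln (h + 1)"
  have L: "1 / 33 \<le> L"
  proof -
    have "ln (inverse (h + 1)) \<le> inverse (h + 1) - 1" using h by (intro ln_le_minus_one) auto
    then have "1 - inverse (h + 1) \<le> L" using h by (simp add: L_def ln_inverse)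
    moreover have "inverse (h + 1) \<le> 32 / 33" using h by (simp add: field_simps)
    ultimately show ?thesis by simp
  qed
  have "log 2 h \<le> 2 * L"
  proof -
    have "ln (inverse 2) \<le> inverse 2 - (1::real)" by (intro ln_le_minus_one) auto
    moreover have "ln (inverse 2) = - ln (2::real)" by (rule ln_inverse)
    ultimately have l2: "1 / 2 \<le> ln (2::real)" by simp
    have "ln h \<le> L" using h by (simp add: L_def)
    also have "\<dots> \<le> 2 * L * ln 2" using l2 L mult_left_mono[of "1/2" "ln 2" "2 * L"] by simp
    finally show ?thesis using l2 by (simp add: log_def field_simps)
  qed
  \<comment> \<open>The factor 256 is \<open>8 * 32\<close>: it brings each far term down to
    \<open>l / 32\<close>.\<close>
  define m where "m = \<lceil>log 2 (256 * \<alpha> / l)\<rceil>"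
  define n where "n = \<lceil>log 2 (256 * \<beta> / l)\<rceil>"
  have "256 * \<alpha> / l * 2 powr - m \<le> 1" "256 * \<beta> / l * 2 powr - n \<le> 1"
    unfolding m_def n_def
    using pos ceiling_log_powr_le[of "256 * \<alpha> / l"] ceiling_log_powr_le[of "256 * \<beta> / l"] by simp_all
  then have far: "8 * \<alpha> * 2 powr - m \<le> l / 32" "8 * \<beta> * 2 powr - n \<le> l / 32"
    using pos by (auto simp: field_simps)
  have near: "l / 16 < 16 * M * real_of_int (max 0 (m + n))" using dyadic[of m n] far by simp
  have mn: "real_of_int (m + n) \<le> log 2 (256 * \<alpha> / l) + log 2 (256 * \<beta> / l) + 2"
    unfolding m_def n_def of_int_add by linarith
  have "256 * \<alpha> / l * (256 * \<beta> / l) = 2 ^ 16 * (h * h)"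
    using pos by (simp add: h_def field_simps)
  then have "log 2 (256 * \<alpha> / l) + log 2 (256 * \<beta> / l) = log 2 (2 ^ 16 * (h * h))"
    using pos log_mult_pos[of "256 * \<alpha> / l" "256 * \<beta> / l" 2] by simp
  also have "\<dots> = log 2 (2 ^ 16) + 2 * log 2 h"
    using h log_mult_pos[of "2 ^ 16" "h * h" 2] log_mult_pos[of h h 2] by simp
  also have "log 2 (2 ^ 16) = (16 :: real)" by (subst log_nat_power) auto
  finally have "real_of_int (m + n) \<le> 18 + 2 * log 2 h" using mn by simp
  \<comment> \<open>\<open>18 \<le> 594 * L\<close> from \<open>L \<ge> 1 / 33\<close>, and
    \<open>2 * log 2 h \<le> 4 * L\<close>; 598 is rounded up to 600.\<close>
  also have "\<dots> \<le> 600 * L" using L \<open>log 2 h \<le> 2 * L\<close> by simp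
  finally have "real_of_int (max 0 (m + n)) \<le> 600 * L" using L by (auto simp: max_def)
  then have "16 * M * real_of_int (max 0 (m + n)) \<le> 16 * M * (600 * L)"
    using pos by (intro mult_left_mono) auto
  \<comment> \<open>The constant is \<open>16 * 16 * 600\<close>.\<close>
  then have "l < 153600 * L * M" using near by (simp add: algebra_simps)
  then show ?thesis using L unfolding h_def[symmetric] L_def[symmetric] by (simp add: field_simps)
qed

text \<open>Hoelder's inequality with the operator norm of one projection bounded by 1 leaves the
  trace of the other; Cauchy--Schwarz gives the symmetric bound. On rank-one projections the first
  two control rows and columns, and the third is the upper estimate of the theorem.\<close>

lemma projection_pairing_le:
  assumes T: "lin_map N T" and N: "0 < N" and ne: "X0 \<in> carrier_mat N N" "T X0 \<noteq> 0\<^sub>m N N"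
    and P: "orth_proj N P" and Q: "orth_proj N Q"
  shows "cmod (hs_inner (T P) Q) \<le> map_norm (schatten 1) N T * Re (mtrace P)"
    and "cmod (hs_inner (T P) Q) \<le> map_norm op_norm N T * Re (mtrace Q)"
    and "cmod (hs_inner (T P) Q) \<le> map_norm (schatten 2) N T * sqrt (Re (mtrace P) * Re (mtrace Q))"
proof -
  have Pc: "P \<in> carrier_mat N N" "Q \<in> carrier_mat N N" using P Q by (simp_all add: orth_proj_def)
  have TP: "T P \<in> carrier_mat N N" using T Pc by (simp add: lin_map_def)
  have "cmod (hs_inner (T P) Q) \<le> schatten 1 (T P) * op_norm Q" by (rule holder_schatten_1_op_norm[OF TP Pc(2)])
  also have "\<dots> \<le> schatten 1 (T P) * 1"
    using orth_proj_op_norm_le[OF Q N] fro_le_schatten_1[OF TP] fro_nonneg[of "T P"]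
    by (intro mult_left_mono) linarith+
  also have "\<dots> \<le> map_norm (schatten 1) N T * schatten 1 P"
    using map_norm_upper[OF T, of 1 "real N" "schatten 1" P] fro_le_schatten_1 schatten_1_le_fro Pc by simp
  finally show "cmod (hs_inner (T P) Q) \<le> map_norm (schatten 1) N T * Re (mtrace P)"
    by (simp only: orth_proj_schatten_1[OF P])
  have up: "op_norm (T P) \<le> map_norm op_norm N T * op_norm P"
    by (rule map_norm_upper[OF T, of "real N * real N" 1]) (use N fro_le_op_norm op_norm_le_fro Pc in auto)
  have mn: "0 < map_norm op_norm N T"
    by (rule map_norm_pos[OF T, of "real N * real N" 1, OF _ _ _ _ ne]) (use N fro_le_op_norm op_norm_le_fro in auto)
  have "cmod (hs_inner (T P) Q) = cmod (hs_inner Q (T P))" using hs_inner_commute[OF TP Pc(2)] by simp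
  also have "\<dots> \<le> schatten 1 Q * op_norm (T P)" by (rule holder_schatten_1_op_norm[OF Pc(2) TP])
  also have "\<dots> \<le> schatten 1 Q * (map_norm op_norm N T * 1)"
    using orth_proj_op_norm_le[OF P N] fro_le_schatten_1[OF Pc(2)] fro_nonneg[of Q] mn
    by (intro mult_left_mono order.trans[OF up]) linarith+
  finally show "cmod (hs_inner (T P) Q) \<le> map_norm op_norm N T * Re (mtrace Q)"
    by (simp only: orth_proj_schatten_1[OF Q] mult_1_right mult.commute[of "Re _"])
  have "cmod (hs_inner (T P) Q) \<le> fro (T P) * fro Q" by (rule cmod_hs_inner_le[OF TP Pc(2)])
  also have "\<dots> \<le> map_norm (schatten 2) N T * fro P * fro Q"
    using map_norm_upper[OF T, of 1 1 "schatten 2" P] Pc TP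
    by (intro mult_right_mono) (simp_all add: schatten_2_eq_fro[of _ N])
  also have "\<dots> = map_norm (schatten 2) N T * sqrt (Re (mtrace P) * Re (mtrace Q))"
    by (simp add: orth_proj_mtrace[OF P] orth_proj_mtrace[OF Q] real_sqrt_mult)
  finally show "cmod (hs_inner (T P) Q) \<le> map_norm (schatten 2) N T * sqrt (Re (mtrace P) * Re (mtrace Q))" .
qed

section \<open>Choice of the projections and the two inequalities\<close>

theorem theorem4p2:
  shows "\<exists>C::real. C > 1 \<and>
    (\<forall>N::nat. \<forall>T. N \<ge> 1 \<longrightarrow> lin_map N T \<longrightarrow> (\<exists>X \<in> carrier_mat N N. T X \<noteq> 0\<^sub>m N N) \<longrightarrow>
      (\<exists>P Q. orth_proj N P \<and> P \<noteq> 0\<^sub>m N N \<and> orth_proj N Q \<and> Q \<noteq> 0\<^sub>m N N \<and>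
         map_norm (schatten 2) N T / (C * ln (height N T + 1))
           < cmod (hs_inner (T P) Q) / sqrt (Re (mtrace P) * Re (mtrace Q)) \<and>
         cmod (hs_inner (T P) Q) / sqrt (Re (mtrace P) * Re (mtrace Q))
           \<le> map_norm (schatten 2) N T))"
proof (intro exI[of _ "153600 :: real"] conjI allI impI)
  fix N :: nat and T
  assume N1: "1 \<le> N" and T: "lin_map N T" and "\<exists>X \<in> carrier_mat N N. T X \<noteq> 0\<^sub>m N N"
  then obtain X0 where ne: "X0 \<in> carrier_mat N N" "T X0 \<noteq> 0\<^sub>m N N" and N: "0 < N" by auto
  define l where "l = map_norm (schatten 2) N T"
  define \<alpha> where "\<alpha> = map_norm (schatten 1) N T"
  define \<beta> where "\<beta> = map_norm op_norm N T"
  have l: "0 < l" unfolding l_def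
    by (rule map_norm_pos[OF T, of 1 1, OF _ _ _ _ ne]) (simp_all add: schatten_2_eq_fro[of _ N])
  have \<alpha>: "0 < \<alpha>" unfolding \<alpha>_def
    by (rule map_norm_pos[OF T, of 1 "real N", OF _ _ _ _ ne])
       (use fro_le_schatten_1 schatten_1_le_fro in auto)
  have \<beta>: "0 < \<beta>" unfolding \<beta>_def
    by (rule map_norm_pos[OF T, of "real N * real N" 1, OF _ _ _ _ ne])
       (use N fro_le_op_norm op_norm_le_fro in auto)
  obtain H K where H: "H \<in> carrier_mat N N" "adj H = H" "fro H \<le> 1"
    and K: "K \<in> carrier_mat N N" "adj K = K" "fro K \<le> 1" and HK: "l / 8 < cmod (hs_inner K (T H))"
    unfolding l_def by (rule near_extremal_hermitian_pair[OF T ne])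
  obtain U x where U: "unitary N U" and x: "H = spec_mat N U (\<lambda>i. complex_of_real (x i))"
    using hermitian_spectral[OF H(1,2)] by blast
  obtain V y where V: "unitary N V" and y: "K = spec_mat N V (\<lambda>i. complex_of_real (y i))"
    using hermitian_spectral[OF K(1,2)] by blast
  have sx: "(\<Sum>i<N. (x i)\<^sup>2) \<le> 1" and sy: "(\<Sum>i<N. (y i)\<^sup>2) \<le> 1"
    using fro_hermitian_spec_mat[OF U, of x] fro_hermitian_spec_mat[OF V, of y] H(3) K(3)
    by (simp_all add: x y power_le_one flip: fro_hermitian_spec_mat[OF U] fro_hermitian_spec_mat[OF V])
  define b where "b i j = hs_inner (spec_proj N V {j}) (T (spec_proj N U {i}))" for i j
  have b_sum: "hs_inner K (T H) = (\<Sum>i<N. \<Sum>j<N. of_real (x i * y j) * b i j)"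
    unfolding x y b_def by (rule hs_inner_spec_mats[OF T U V])
  have PQ: "orth_proj N (spec_proj N U S)" "orth_proj N (spec_proj N V S)" for S
    using orth_proj_spec_proj U V by auto
  have b_set: "cmod (\<Sum>i\<in>S. \<Sum>j\<in>R. b i j) = cmod (hs_inner (T (spec_proj N U S)) (spec_proj N V R))"
    if "S \<subseteq> {..<N}" "R \<subseteq> {..<N}" for S R
  proof -
    have "T (spec_proj N U S) \<in> carrier_mat N N" "spec_proj N V R \<in> carrier_mat N N"
      using T PQ by (auto simp: lin_map_def orth_proj_def)
    then show ?thesis
      using hs_inner_commute[of "T (spec_proj N U S)" N N "spec_proj N V R"]
      by (simp add: b_def flip: hs_inner_spec_projs[OF T U V that])
  qed
  have tr: "Re (mtrace (spec_proj N U S)) = real (card S)" "Re (mtrace (spec_proj N V S)) = real (card S)"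
    if "S \<subseteq> {..<N}" for S
    using mtrace_spec_proj[OF U that] mtrace_spec_proj[OF V that] by simp_all
  note pair = projection_pairing_le[OF T N ne PQ(1) PQ(2), folded l_def \<alpha>_def \<beta>_def]
  \<comment> \<open>A singleton index set gives a projection of trace 1, so the trace factor
    disappears here and for the columns.\<close>
  have row: "cmod (\<Sum>j\<in>R. b i j) \<le> \<alpha>" if "i < N" "R \<subseteq> {..<N}" for i R
    using pair(1)[of "{i}" R] b_set[of "{i}" R] tr(1)[of "{i}"] that by simp
  have col: "cmod (\<Sum>i\<in>S. b i j) \<le> \<beta>" if "j < N" "S \<subseteq> {..<N}" for j S
    using pair(2)[of S "{j}"] b_set[of S "{j}"] tr(2)[of "{j}"] that by simp
  obtain S R M where SR: "S \<subseteq> {..<N}" "S \<noteq> {}" "R \<subseteq> {..<N}" "R \<noteq> {}" and M: "0 \<le> M"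
    and M_eq: "M = cmod (\<Sum>i\<in>S. \<Sum>j\<in>R. b i j) / sqrt (real (card S) * real (card R))"
    and M_max: "\<forall>S' R'. S' \<subseteq> {..<N} \<longrightarrow> R' \<subseteq> {..<N} \<longrightarrow>
      cmod (\<Sum>i\<in>S'. \<Sum>j\<in>R'. b i j) \<le> M * sqrt (real (card S') * real (card R'))"
    by (rule max_subset_ratio[OF N])
  have "l / (153600 * ln (sqrt (\<alpha> * \<beta>) / l + 1)) < M"
  proof (rule ratio_lower_bound[OF l \<alpha> \<beta> M])
    show "l / 8 < 2 * (t * \<alpha> + \<beta> / t)" if "0 < t" for t
      using HK unfolding b_sum
      by (rule less_le_trans, intro schur_test) (use sx sy \<alpha> \<beta> that row col in auto)
    show "l / 8 < 16 * M * real_of_int (max 0 (m + n)) + 8 * \<alpha> * 2 powr - real_of_int m + 8 * \<beta> * 2 powr - real_of_int n" for m n :: int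
      using HK unfolding b_sum
      by (rule less_le_trans, intro dyadic_bilinear_le) (use sx sy \<alpha> \<beta> M M_max row col in auto)
  qed
  then have lower: "l / (153600 * ln (height N T + 1)) < M"
    by (simp add: height_def l_def \<alpha>_def \<beta>_def)
  have cards: "0 < card S" "0 < card R"
    using SR finite_subset[OF _ finite_lessThan] by (auto simp: card_gt_0_iff)
  let ?P = "spec_proj N U S" and ?Q = "spec_proj N V R"
  have M_pq: "M = cmod (hs_inner (T ?P) ?Q) / sqrt (Re (mtrace ?P) * Re (mtrace ?Q))"
    by (simp add: M_eq b_set[OF SR(1,3)] tr[OF SR(1)] tr[OF SR(3)])
  have "mtrace (0\<^sub>m N N) = 0" by (simp add: mtrace_def)
  \<comment> \<open>The traces are the cardinalities of \<open>S\<close> and \<open>R\<close>, which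
    are positive.\<close>
  then have nz: "?P \<noteq> 0\<^sub>m N N" "?Q \<noteq> 0\<^sub>m N N"
    using cards tr(1)[OF SR(1)] tr(2)[OF SR(3)] by force+
  have "M \<le> l"
    unfolding M_pq using pair(3)[of S R] cards tr(1)[OF SR(1)] tr(2)[OF SR(3)] by (simp add: divide_le_eq)
  then show "\<exists>P Q. orth_proj N P \<and> P \<noteq> 0\<^sub>m N N \<and> orth_proj N Q \<and> Q \<noteq> 0\<^sub>m N N \<and>
      map_norm (schatten 2) N T / (153600 * ln (height N T + 1))
        < cmod (hs_inner (T P) Q) / sqrt (Re (mtrace P) * Re (mtrace Q)) \<and>
      cmod (hs_inner (T P) Q) / sqrt (Re (mtrace P) * Re (mtrace Q)) \<le> map_norm (schatten 2) N T"
    using PQ nz lower unfolding M_pq l_def by blast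
qed simp

end
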